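(* Let $G$ be a tournament with $n$ vertices and adjacency matrix $A$. Let $\tau_1<\tau_2<\cdots<\tau_s$ be the distinct eigenvalues of the Seidel matrix $S=\sqrt{-1}(A-A^T)$, let $\beta_i$ be the main angle of $\tau_i$ and $m_i$ the multiplicity of $\tau_i$. Then: (1) If $\beta_1=0$, then $\mathrm{Rep}(G)=n-m_1-1$, and the representation of $G$ in $\Omega(\mathrm{Rep}(G))$ has $\alpha=(1-c_1\sqrt{-1})/(1+c_1\tau_1)$, where $c_1=\sum_{i=2}^s n\beta_i^2/(\tau_i-\tau_1)$. (2) If $\beta_1\neq0$ and $m_1>1$, then $\mathrm{Rep}(G)=n-m_1$, and the representation of $G$ in $\Omega(\mathrm{Rep}(G))$ has $\alpha=-\sqrt{-1}/\tau_1$. (3) If $m_1=1$, $\beta_2=0$ and $c_2<0$, where $c_2=n\beta_1^2/(\tau_1-\tau_2)+\sum_{i=3}^s n\beta_i^2/(\tau_i-\tau_2)$, then $\mathrm{Rep}(G)=n-m_2-1$, and the representation of $G$ in $\Omega(\mathrm{Rep}(G))$ has $\alpha=(1-c_2\sqrt{-1})/(1+c_2\tau_2)$. (4) In all other cases, $\mathrm{Rep}(G)=n-1$.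
   Context: $\Omega(d)=\{x\in\mathbb C^d: x^*x=1\}$ is the complex unit sphere, where $x^*$ is the conjugate transpose. A tournament is a pair $(V,E)$ with $V$ finite and $E\subset V\times V$ such that $E\cap E^T=\emptyset$ and $E\cup E^T\cup\{(x,x):x\in V\}=V\times V$, where $E^T=\{(x,y):(y,x)\in E\}$. Its adjacency matrix $A$ is indexed by $V$ with $A_{xy}=1$ if $(x,y)\in E$ and $0$ otherwise. Its Seidel matrix is $S=\sqrt{-1}(A-A^T)$. A tournament $(V,E)$ is representable in $\Omega(d)$ if there is a map $\varphi:V\to\Omega(d)$ and a complex number $\alpha$ with $\mathrm{Im}(\alpha)>0$ such that for all distinct $x,y\in V$, $\varphi(x)^*\varphi(y)=\alpha$ if $(x,y)\in E$ and $\varphi(x)^*\varphi(y)=\overline{\alpha}$ if $(y,x)\in E$; such $\varphi$ is a representation, and $\alpha$ is its angle. $\mathrm{Rep}(G)$ is the smallest $d$ such that $G$ is representable in $\Omega(d)$. For a Hermitian $n\times n$ matrix with distinct eigenvalues $\tau_1<\cdots<\tau_s$, let $E_i$ be the orthogonal projection onto the eigenspace of $\tau_i$ and $j$ the all-ones vector; the main angle of $\tau_i$ is $\beta_i=\frac1{\sqrt n}\sqrt{(E_ij)^*(E_ij)}$.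
   Formalization: The formal theorem assumes n ≥ 2: for n = 1 case (4) would give Rep(G) = 0, but Ω(0) is empty and Rep(G) = 1, and for n = 0 there is no eigenvalue τ_1. *)

theory Defs
  imports "Jordan_Normal_Form.Jordan_Normal_Form_Uniqueness"
begin

definition cinner :: "complex vec \<Rightarrow> complex vec \<Rightarrow> complex" where
  "cinner x y = (\<Sum>i<dim_vec x. cnj (x $ i) * y $ i)"

definition Omega :: "nat \<Rightarrow> complex vec set" where
  "Omega d = {x. x \<in> carrier_vec d \<and> cinner x x = 1}"

definition tournament :: "'a set \<Rightarrow> ('a \<times> 'a) set \<Rightarrow> bool" where
  "tournament V E \<longleftrightarrow> finite V \<and> E \<subseteq> V \<times> V \<and> E \<inter> E\<inverse> = {} \<and>
     E \<union> E\<inverse> \<union> {(x, x) | x. x \<in> V} = V \<times> V"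

definition vert_enum :: "'a set \<Rightarrow> nat \<Rightarrow> 'a" where
  "vert_enum V = (SOME f. bij_betw f {0..<card V} V)"

definition adj_mat :: "'a set \<Rightarrow> ('a \<times> 'a) set \<Rightarrow> complex mat" where
  "adj_mat V E = mat (card V) (card V)
     (\<lambda>(i, j). if (vert_enum V i, vert_enum V j) \<in> E then 1 else 0)"

definition seidel_mat :: "'a set \<Rightarrow> ('a \<times> 'a) set \<Rightarrow> complex mat" where
  "seidel_mat V E = \<i> \<cdot>\<^sub>m (adj_mat V E - transpose_mat (adj_mat V E))"

definition is_representation ::
  "'a set \<Rightarrow> ('a \<times> 'a) set \<Rightarrow> nat \<Rightarrow> ('a \<Rightarrow> complex vec) \<Rightarrow> complex \<Rightarrow> bool" where
  "is_representation V E d \<phi> \<alpha> \<longleftrightarrow> Im \<alpha> > 0 \<and> (\<forall>x\<in>V. \<phi> x \<in> Omega d) \<and>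
     (\<forall>x\<in>V. \<forall>y\<in>V. x \<noteq> y \<longrightarrow>
        ((x, y) \<in> E \<longrightarrow> cinner (\<phi> x) (\<phi> y) = \<alpha>) \<and>
        ((y, x) \<in> E \<longrightarrow> cinner (\<phi> x) (\<phi> y) = cnj \<alpha>))"

definition representable :: "'a set \<Rightarrow> ('a \<times> 'a) set \<Rightarrow> nat \<Rightarrow> bool" where
  "representable V E d \<longleftrightarrow> (\<exists>\<phi> \<alpha>. is_representation V E d \<phi> \<alpha>)"

definition Rep :: "'a set \<Rightarrow> ('a \<times> 'a) set \<Rightarrow> nat" where
  "Rep V E = (LEAST d. representable V E d)"

(* distinct eigenvalues of a Hermitian matrix, as reals, in increasing order:
   eig_list M ! (i-1) is tau_i *)
definition eig_list :: "complex mat \<Rightarrow> real list" where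
  "eig_list M = sorted_list_of_set {t::real. eigenvalue M (complex_of_real t)}"

definition eigenspace :: "complex mat \<Rightarrow> complex \<Rightarrow> complex vec set" where
  "eigenspace M t = {v. v \<in> carrier_vec (dim_row M) \<and> M *\<^sub>v v = t \<cdot>\<^sub>v v}"

definition eig_proj :: "complex mat \<Rightarrow> complex \<Rightarrow> complex vec \<Rightarrow> complex vec" where
  "eig_proj M t v = (THE p. p \<in> eigenspace M t \<and>
       (\<forall>w\<in>eigenspace M t. cinner w (v - p) = 0))"

(* multiplicity of an eigenvalue (geometric = algebraic for Hermitian matrices) *)
definition eig_mult :: "complex mat \<Rightarrow> complex \<Rightarrow> nat" where
  "eig_mult M t = dim_gen_eigenspace M t 1"

definition main_angle :: "complex mat \<Rightarrow> complex \<Rightarrow> real" where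
  "main_angle M t = (let n = dim_row M; p = eig_proj M t (vec n (\<lambda>_. 1)) in
      (1 / sqrt (real n)) * sqrt (Re (cinner p p)))"

end

theory Submission
  imports Defs "Jordan_Normal_Form.Spectral_Radius" "HOL-Analysis.L2_Norm"
begin

text \<open>The Gram matrix of a representation with angle \<open>\<alpha> = a + b \<i>\<close> is
  \<open>(1 - a) I + a J + b S = b (S - \<theta> I + c J)\<close> with \<open>\<theta> = (a - 1) / b\<close> and \<open>c = a / b\<close>, so that
  \<open>\<alpha> = (c + \<i>) / (c - \<theta>)\<close>, and \<open>Rep G\<close> is the least rank of a positive semidefinite matrix
  \<open>S - \<theta> I + c J\<close>. In an eigenbasis of \<open>S\<close> this is a diagonal matrix plus a rank one matrix. As
  \<open>c J\<close> can repair at most one negative eigenvalue, semidefiniteness forces \<open>\<theta> \<le> \<tau>\<^sub>1\<close>, or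
  \<open>\<tau>\<^sub>1 < \<theta> \<le> \<tau>\<^sub>2\<close> and \<open>m\<^sub>1 = 1\<close>. The rank is at least \<open>n - 1\<close> unless \<open>\<theta>\<close> is an eigenvalue; at an
  eigenvalue with vanishing main angle it drops by one more precisely when
  \<open>c = - 1 / C \<theta>\<close>, where \<open>C \<theta>\<close> is the constant \<open>c\<^sub>1\<close> or \<open>c\<^sub>2\<close> of the theorem.\<close>

section \<open>The spectral theorem for Hermitian matrices\<close>

text \<open>Let \<open>g\<close> hold the coordinates of the all-ones vector. A kernel vector
  satisfies (\<mu> k - \<theta>) x k = - c s g k, where s is the inner product of g and x. Off the
  eigenvalue \<theta> it is thus a multiple of g k / (\<mu> k - \<theta>), and substituting this
  into s gives s (1 + c C) = 0: this is the origin of \<open>C \<theta>\<close> and of the value - 1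
  / C. The delicate point is that this one value of c has to make the form singular and semidefinite
  at once. With no entry below \<theta> this is the Cauchy-Schwarz inequality, whose equality case
  is the same vector; with one entry below \<theta> a reversed inequality is needed, and the sign of
  C decides. At an eigenvalue with nonzero main angle a nonzero c costs one more dimension, which is
  why the angle in case (2) belongs to c = 0. Ranks are never computed. Lower bounds count unknowns
  against d linear equations, upper bounds exhibit independent kernel vectors.\<close>

lemma homogeneous_system_nontrivial:
  fixes F :: "nat \<Rightarrow> nat \<Rightarrow> 'a::field"
  assumes "finite R" "d < card R"
  shows "\<exists>x. (\<exists>k\<in>R. x k \<noteq> 0) \<and> (\<forall>i<d. (\<Sum>k\<in>R. F i k * x k) = 0)"
  using assms
proof (induction d arbitrary: R F)
  case 0
  then obtain k where "k \<in> R" by (metis card_gt_0_iff ex_in_conv)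
  then show ?case by (intro exI[of _ "\<lambda>_. 1"]) auto
next
  case (Suc d)
  show ?case
  proof (cases "\<exists>p\<in>R. F d p \<noteq> 0")
    case False
    obtain x where "\<exists>k\<in>R. x k \<noteq> 0" "\<forall>i<d. (\<Sum>k\<in>R. F i k * x k) = 0"
      using Suc.IH[of R F] Suc.prems by auto
    with False show ?thesis by (intro exI[of _ x]) (auto simp: less_Suc_eq)
  next
    case True
    then obtain p where p: "p \<in> R" "F d p \<noteq> 0" by auto
    let ?R = "R - {p}"
    \<comment> \<open>The system after equation \<open>d\<close> has eliminated the unknown
      \<open>p\<close>; \<open>t\<close> below is the back substitution.\<close>
    let ?G = "\<lambda>i k. F i k - F i p * F d k / F d p"
    have "finite ?R" "d < card ?R" using Suc.prems p by auto
    from Suc.IH[OF this, of ?G] obtain x where x: "\<exists>k\<in>?R. x k \<noteq> 0"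
      "\<forall>i<d. (\<Sum>k\<in>?R. ?G i k * x k) = 0" by blast
    define t where "t = - (\<Sum>k\<in>?R. F d k * x k) / F d p"
    let ?x = "x(p := t)"
    have split: "(\<Sum>k\<in>R. F i k * ?x k) = F i p * t + (\<Sum>k\<in>?R. F i k * x k)" for i
      using Suc.prems p by (subst sum.remove[of _ p]) (auto intro!: sum.cong)
    have "(\<Sum>k\<in>R. F i k * ?x k) = 0" if "i < Suc d" for i
    proof (cases "i = d")
      case True
      have "F d p * t + (\<Sum>k\<in>?R. F d k * x k) = 0" using p by (simp add: t_def)
      then show ?thesis unfolding True split .
    next
      case False
      then have "0 = (\<Sum>k\<in>?R. ?G i k * x k)" using x that by simp
      also have "\<dots> = (\<Sum>k\<in>?R. F i k * x k) - (\<Sum>k\<in>?R. F i p / F d p * (F d k * x k))"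
        by (simp add: sum_subtractf[symmetric] algebra_simps)
      also have "\<dots> = (\<Sum>k\<in>?R. F i k * x k) + F i p * t"
        unfolding sum_distrib_left[symmetric] by (simp add: t_def)
      finally show ?thesis unfolding split by (simp add: add.commute)
    qed
    then show ?thesis using x(1) by (intro exI[of _ ?x]) auto
  qed
qed

definition orthonormal :: "nat \<Rightarrow> nat \<Rightarrow> (nat \<Rightarrow> nat \<Rightarrow> complex) \<Rightarrow> bool" where
  "orthonormal n m u \<longleftrightarrow>
     (\<forall>k<m. \<forall>l<m. (\<Sum>i<n. cnj (u k i) * u l i) = (if k = l then 1 else 0))"

lemma sum_cnj_mult_self: "(\<Sum>i\<in>I. cnj (x i) * x i) = of_real (\<Sum>i\<in>I. (cmod (x i))\<^sup>2)"
  by (simp add: complex_norm_square mult.commute del: of_real_power)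

lemma unit_vector_exists:
  fixes n :: nat
  assumes "i0 < n" "w i0 \<noteq> 0"
  shows "\<exists>r>0. (\<Sum>i<n. cnj (of_real r * w i) * (of_real r * w i)) = 1"
proof -
  define N where "N = (\<Sum>i<n. (cmod (w i))\<^sup>2)"
  have "N > 0" unfolding N_def by (rule sum_pos2[where i = i0]) (use assms in auto)
  have "(\<Sum>i<n. cnj (of_real r * w i) * (of_real r * w i))
      = of_real (r\<^sup>2) * (\<Sum>i<n. cnj (w i) * w i)" for r
    unfolding sum_distrib_left by (intro sum.cong refl) (simp add: power2_eq_square)
  then have "(\<Sum>i<n. cnj (of_real (1 / sqrt N) * w i) * (of_real (1 / sqrt N) * w i))
      = of_real ((1 / sqrt N)\<^sup>2) * (\<Sum>i<n. cnj (w i) * w i)" .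
  also have "\<dots> = of_real ((1 / sqrt N)\<^sup>2 * N)"
    unfolding sum_cnj_mult_self N_def by simp
  also have "(1 / sqrt N)\<^sup>2 * N = 1" using \<open>N > 0\<close> by (simp add: power_divide)
  finally show ?thesis using \<open>N > 0\<close> by (intro exI[of _ "1 / sqrt N"]) auto
qed

lemma orthonormal_snoc:
  assumes "orthonormal n k u" "(\<Sum>i<n. cnj (v i) * v i) = 1"
    "\<And>l. l < k \<Longrightarrow> (\<Sum>i<n. cnj (u l i) * v i) = 0"
  shows "orthonormal n (Suc k) (u(k := v))"
proof -
  have "(\<Sum>i<n. cnj (v i) * u l i) = 0" if "l < k" for l
  proof -
    have "(\<Sum>i<n. cnj (v i) * u l i) = cnj (\<Sum>i<n. cnj (u l i) * v i)" by (simp add: mult.commute)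
    then show ?thesis using assms(3)[OF that] by simp
  qed
  then show ?thesis using assms unfolding orthonormal_def by (auto simp: less_Suc_eq)
qed

text \<open>Each new direction solves the \<open>k < n\<close> orthogonality equations in
  \<open>n\<close> unknowns and is then normalized. The given vectors stay in place as a
  prefix.\<close>

lemma orthonormal_extend:
  assumes "orthonormal n k u" "k \<le> n"
  shows "\<exists>u'. orthonormal n n u' \<and> (\<forall>l<k. u' l = u l)"
  using assms
proof (induction "n - k" arbitrary: k u)
  case 0
  then show ?case by auto
next
  case (Suc m)
  then have "k < n" by simp
  obtain w where w: "\<exists>i\<in>{..<n}. w i \<noteq> 0" "\<forall>l<k. (\<Sum>i\<in>{..<n}. cnj (u l i) * w i) = 0"
    using homogeneous_system_nontrivial[of "{..<n}" k "\<lambda>l i. cnj (u l i)"] \<open>k < n\<close> by auto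
  then obtain r where r: "r > 0" "(\<Sum>i<n. cnj (of_real r * w i) * (of_real r * w i)) = 1"
    using unit_vector_exists by blast
  let ?v = "\<lambda>i. of_real r * w i"
  have "(\<Sum>i<n. cnj (u l i) * ?v i) = 0" if "l < k" for l
  proof -
    have "(\<Sum>i<n. cnj (u l i) * ?v i) = of_real r * (\<Sum>i<n. cnj (u l i) * w i)"
      by (simp add: sum_distrib_left algebra_simps)
    then show ?thesis using w(2) that by simp
  qed
  then have "orthonormal n (Suc k) (u(k := ?v))"
    using orthonormal_snoc[OF Suc.prems(1) r(2)] by blast
  moreover have "m = n - Suc k" "Suc k \<le> n" using Suc.hyps(2) by auto
  ultimately obtain u' where u': "orthonormal n n u'" "\<forall>l<Suc k. u' l = (u(k := ?v)) l"
    using Suc.hyps(1)[of "Suc k" "u(k := ?v)"] by blast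
  then have "\<forall>l<k. u' l = u l" by auto
  then show ?case using u' by blast
qed

text \<open>Orthonormality says that the matrix with columns \<open>u k\<close> has its adjoint as
  left inverse; for square matrices this is also a right inverse.\<close>

lemma orthonormal_complete:
  assumes "orthonormal n n u" "i < n" "j < n"
  shows "(\<Sum>k<n. u k i * cnj (u k j)) = (if i = j then 1 else 0)"
proof -
  define P where "P = mat n n (\<lambda>(i, k). u k i)"
  define Q where "Q = mat n n (\<lambda>(k, i). cnj (u k i))"
  have "Q * P = 1\<^sub>m n"
    by (rule eq_matI)
      (use assms(1) in \<open>auto simp: P_def Q_def scalar_prod_def orthonormal_def atLeast0LessThan\<close>)
  then have "P * Q = 1\<^sub>m n"
    by (intro mat_mult_left_right_inverse[of Q n P]) (auto simp: P_def Q_def)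
  then have "(P * Q) $$ (i, j) = 1\<^sub>m n $$ (i, j)" by simp
  then show ?thesis using assms(2,3) by (simp add: P_def Q_def scalar_prod_def atLeast0LessThan)
qed

lemma orthonormal_expansion:
  assumes "orthonormal n n u" "i < n"
  shows "x i = (\<Sum>k<n. (\<Sum>j<n. cnj (u k j) * x j) * u k i)"
proof -
  have "(\<Sum>k<n. (\<Sum>j<n. cnj (u k j) * x j) * u k i) = (\<Sum>j<n. x j * (\<Sum>k<n. u k i * cnj (u k j)))"
    unfolding sum_distrib_left sum_distrib_right by (subst sum.swap) (simp add: algebra_simps)
  also have "\<dots> = (\<Sum>j<n. if i = j then x j else 0)"
    by (rule sum.cong) (use assms in \<open>auto simp: orthonormal_complete\<close>)
  finally show ?thesis using assms(2) by simp
qed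

lemma orthonormal_eqI:
  assumes "orthonormal n n u" "i < n"
    "\<And>k. k < n \<Longrightarrow> (\<Sum>j<n. cnj (u k j) * x j) = (\<Sum>j<n. cnj (u k j) * y j)"
  shows "x i = y i"
  unfolding orthonormal_expansion[OF assms(1,2), of x] orthonormal_expansion[OF assms(1,2), of y]
  using assms(3) by simp

lemma hermitian_form_swap:
  fixes A :: "nat \<Rightarrow> nat \<Rightarrow> complex"
  assumes "\<And>i j. i < n \<Longrightarrow> j < n \<Longrightarrow> A i j = cnj (A j i)"
  shows "(\<Sum>i<n. cnj (x i) * (\<Sum>j<n. A i j * y j)) = (\<Sum>j<n. cnj (\<Sum>i<n. A j i * x i) * y j)"
proof -
  have A: "cnj (A j i) = A i j" if "i < n" "j < n" for i j
    using assms[OF that] by (rule sym)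
  have "(\<Sum>i<n. cnj (x i) * (\<Sum>j<n. A i j * y j)) = (\<Sum>i<n. \<Sum>j<n. cnj (x i) * A i j * y j)"
    by (simp add: sum_distrib_left mult.assoc)
  also have "\<dots> = (\<Sum>j<n. \<Sum>i<n. cnj (x i) * A i j * y j)" by (rule sum.swap)
  also have "\<dots> = (\<Sum>j<n. \<Sum>i<n. cnj (A j i * x i) * y j)"
    by (intro sum.cong refl) (simp add: A)
  finally show ?thesis by (simp add: sum_distrib_right)
qed

text \<open>The number \<open>m\<close> of eigenvectors is kept apart from the dimension
  \<open>n\<close> so that a full basis can be built one vector at a time.\<close>

definition eigenbasis ::
  "nat \<Rightarrow> nat \<Rightarrow> (nat \<Rightarrow> nat \<Rightarrow> complex) \<Rightarrow> (nat \<Rightarrow> nat \<Rightarrow> complex) \<Rightarrow> (nat \<Rightarrow> real) \<Rightarrow> bool" where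
  "eigenbasis n m A u \<mu> \<longleftrightarrow> orthonormal n m u \<and>
     (\<forall>k<m. \<forall>i<n. (\<Sum>j<n. A i j * u k j) = of_real (\<mu> k) * u k i)"

text \<open>The orthogonal complement of the eigenvectors found so far is invariant under a
  Hermitian matrix, so an eigenvector of the compression to that complement is an eigenvector of the
  whole matrix.\<close>

lemma eigenbasis_step:
  assumes herm: "\<And>i j. i < n \<Longrightarrow> j < n \<Longrightarrow> A i j = cnj (A j i)"
    and eb: "eigenbasis n k A u \<mu>" and k: "k < n"
  shows "\<exists>v t. eigenbasis n (Suc k) A (u(k := v)) (\<mu>(k := t))"
proof -
  have ou: "orthonormal n k u"
    and eig: "\<And>l i. l < k \<Longrightarrow> i < n \<Longrightarrow> (\<Sum>j<n. A i j * u l j) = of_real (\<mu> l) * u l i"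
    using eb by (auto simp: eigenbasis_def)
  obtain w where w: "orthonormal n n w" and wu: "\<And>l. l < k \<Longrightarrow> w l = u l"
    using orthonormal_extend[OF ou] k by auto
  have wo: "(\<Sum>i<n. cnj (w a i) * w b i) = (if a = b then 1 else 0)" if "a < n" "b < n" for a b
    using w that by (auto simp: orthonormal_def)
  let ?m = "n - k"
  \<comment> \<open>The compression of \<open>A\<close> to the span of the \<open>w l\<close> with
    \<open>k \<le> l\<close>.\<close>
  define B where "B = mat ?m ?m (\<lambda>(p, q). \<Sum>i<n. cnj (w (k + p) i) * (\<Sum>j<n. A i j * w (k + q) j))"
  have Bc: "B \<in> carrier_mat ?m ?m" by (simp add: B_def)
  then obtain z where "eigenvalue B z"
    using spectrum_non_empty[OF Bc] k by (auto simp: spectrum_def)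
  then obtain y where y: "y \<in> carrier_vec ?m" "y \<noteq> 0\<^sub>v ?m" "B *\<^sub>v y = z \<cdot>\<^sub>v y"
    using Bc by (auto simp: eigenvalue_def eigenvector_def)
  define v where "v = (\<lambda>i. \<Sum>q<?m. y $ q * w (k + q) i)"
  have wv: "(\<Sum>i<n. cnj (w l i) * v i) = (if l < k then 0 else y $ (l - k))" if "l < n" for l
  proof -
    have "(\<Sum>i<n. cnj (w l i) * v i) = (\<Sum>q<?m. y $ q * (\<Sum>i<n. cnj (w l i) * w (k + q) i))"
      unfolding v_def sum_distrib_left by (subst sum.swap) (simp add: algebra_simps)
    also have "\<dots> = (\<Sum>q<?m. if q = l - k \<and> \<not> l < k then y $ q else 0)"
      by (intro sum.cong refl) (use that in \<open>auto simp: wo\<close>)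
    also have "\<dots> = (if l < k then 0 else y $ (l - k))"
      using that by auto
    finally show ?thesis .
  qed
  have uv: "(\<Sum>i<n. cnj (u l i) * v i) = 0" if "l < k" for l
    using wv[of l] that k by (simp add: wu)
  \<comment> \<open>Both sides are tested against every \<open>w l\<close>. For \<open>l < k\<close>
    they vanish by Hermitian symmetry; for the other \<open>l\<close> this is the eigenvalue
    equation of \<open>B\<close>.\<close>
  have Av: "(\<Sum>j<n. A i j * v j) = z * v i" if "i < n" for i
  proof (rule orthonormal_eqI[OF w that])
    fix l assume l: "l < n"
    show "(\<Sum>i<n. cnj (w l i) * (\<Sum>j<n. A i j * v j)) = (\<Sum>j<n. cnj (w l j) * (z * v j))"
    proof (cases "l < k")
      case True
      have "(\<Sum>i<n. cnj (w l i) * (\<Sum>j<n. A i j * v j)) = (\<Sum>j<n. cnj (\<Sum>i<n. A j i * u l i) * v j)"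
        using hermitian_form_swap[OF herm, where x = "w l" and y = v] True by (simp add: wu)
      also have "\<dots> = of_real (\<mu> l) * (\<Sum>j<n. cnj (u l j) * v j)"
        using eig[OF True] by (simp add: sum_distrib_left mult.assoc)
      also have "\<dots> = z * (\<Sum>j<n. cnj (u l j) * v j)" using uv[OF True] by simp
      also have "\<dots> = (\<Sum>j<n. cnj (w l j) * (z * v j))"
        using True by (simp add: wu sum_distrib_left algebra_simps)
      finally show ?thesis .
    next
      case False
      define p where "p = l - k"
      have p: "l = k + p" "p < ?m" using False l by (auto simp: p_def)
      have "(\<Sum>j<n. A i j * v j) = (\<Sum>q<?m. y $ q * (\<Sum>j<n. A i j * w (k + q) j))" for i
        unfolding v_def sum_distrib_left by (subst sum.swap) (simp add: algebra_simps)
      then have "(\<Sum>i<n. cnj (w l i) * (\<Sum>j<n. A i j * v j))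
          = (\<Sum>i<n. \<Sum>q<?m. y $ q * (cnj (w l i) * (\<Sum>j<n. A i j * w (k + q) j)))"
        by (simp add: sum_distrib_left algebra_simps)
      also have "\<dots> = (\<Sum>q<?m. B $$ (p, q) * y $ q)"
        using p by (subst sum.swap) (simp add: sum_distrib_left B_def algebra_simps)
      also have "\<dots> = (B *\<^sub>v y) $ p"
        using p y(1) Bc by (auto simp: scalar_prod_def atLeast0LessThan intro!: sum.cong)
      also have "\<dots> = z * y $ p" using y p by simp
      also have "\<dots> = z * (\<Sum>j<n. cnj (w l j) * v j)" using wv[OF l] p by simp
      also have "\<dots> = (\<Sum>j<n. cnj (w l j) * (z * v j))" by (simp add: sum_distrib_left algebra_simps)
      finally show ?thesis .
    qed
  qed
  have "\<exists>i<n. v i \<noteq> 0"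
  proof (rule ccontr)
    assume *: "\<not> ?thesis"
    have "y $ p = 0" if "p < ?m" for p
    proof -
      have "(\<Sum>i<n. cnj (w (k + p) i) * v i) = 0" using * by auto
      then show ?thesis using wv[of "k + p"] that by simp
    qed
    then have "y = 0\<^sub>v ?m" using y(1) by (intro eq_vecI) auto
    with y(2) show False by simp
  qed
  then obtain r where r: "r > 0" and v1: "(\<Sum>i<n. cnj (of_real r * v i) * (of_real r * v i)) = 1"
    using unit_vector_exists by blast
  define v' where "v' = (\<lambda>i. of_real r * v i)"
  have Av': "(\<Sum>j<n. A i j * v' j) = z * v' i" if "i < n" for i
  proof -
    have "(\<Sum>j<n. A i j * v' j) = of_real r * (\<Sum>j<n. A i j * v j)"
      by (simp add: v'_def sum_distrib_left algebra_simps)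
    then show ?thesis using Av[OF that] by (simp add: v'_def)
  qed
  have v'1: "(\<Sum>i<n. cnj (v' i) * v' i) = 1" using v1 by (simp add: v'_def)
  have uv': "(\<Sum>i<n. cnj (u l i) * v' i) = 0" if "l < k" for l
  proof -
    have "(\<Sum>i<n. cnj (u l i) * v' i) = of_real r * (\<Sum>i<n. cnj (u l i) * v i)"
      by (simp add: v'_def sum_distrib_left algebra_simps)
    then show ?thesis using uv[OF that] by simp
  qed
  \<comment> \<open>The eigenvalue is real: the form at \<open>v'\<close> is evaluated once with
    \<open>A\<close> acting on the right factor and once on the left.\<close>
  have "z = z * (\<Sum>i<n. cnj (v' i) * v' i)" using v'1 by simp
  also have "\<dots> = (\<Sum>i<n. cnj (v' i) * (\<Sum>j<n. A i j * v' j))"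
    using Av' by (simp add: sum_distrib_left algebra_simps)
  also have "\<dots> = (\<Sum>j<n. cnj (\<Sum>i<n. A j i * v' i) * v' j)"
    by (rule hermitian_form_swap[OF herm])
  also have "\<dots> = cnj z * (\<Sum>i<n. cnj (v' i) * v' i)"
    using Av' by (simp add: sum_distrib_left algebra_simps)
  finally have "z = cnj z" using v'1 by simp
  then have z: "z = of_real (Re z)" by (simp add: complex_eq_iff)
  have "(\<Sum>j<n. A i j * (u(k := v')) l j) = of_real ((\<mu>(k := Re z)) l) * (u(k := v')) l i"
    if "l < Suc k" "i < n" for l i
    using that eig[of l i] Av'[of i] z[symmetric] by (auto simp: less_Suc_eq)
  then have "eigenbasis n (Suc k) A (u(k := v')) (\<mu>(k := Re z))"
    unfolding eigenbasis_def using orthonormal_snoc[OF ou v'1 uv'] by blast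
  then show ?thesis by blast
qed

theorem eigenbasis_exists:
  assumes herm: "\<And>i j. i < n \<Longrightarrow> j < n \<Longrightarrow> A i j = cnj (A j i)"
  shows "\<exists>u \<mu>. eigenbasis n n A u \<mu>"
proof -
  have "\<exists>u \<mu>. eigenbasis n k A u \<mu>" if "k \<le> n" for k
    using that
  proof (induction k)
    case 0
    show ?case by (simp add: eigenbasis_def orthonormal_def)
  next
    case (Suc k)
    then obtain u \<mu> where "eigenbasis n k A u \<mu>" by auto
    with eigenbasis_step[of n A k u \<mu>] herm Suc.prems show ?case by (metis Suc_le_lessD)
  qed
  then show ?thesis by blast
qed

lemma eigenbasis_spectral:
  assumes "eigenbasis n n A u \<mu>" "i < n" "j < n"
  shows "A i j = (\<Sum>k<n. of_real (\<mu> k) * u k i * cnj (u k j))"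
proof -
  have ou: "orthonormal n n u"
    and eig: "\<And>k. k < n \<Longrightarrow> (\<Sum>l<n. A i l * u k l) = of_real (\<mu> k) * u k i"
    using assms by (auto simp: eigenbasis_def)
  have "(\<Sum>k<n. of_real (\<mu> k) * u k i * cnj (u k j)) = (\<Sum>k<n. (\<Sum>l<n. A i l * u k l) * cnj (u k j))"
    using eig by simp
  also have "\<dots> = (\<Sum>l<n. A i l * (\<Sum>k<n. u k l * cnj (u k j)))"
    unfolding sum_distrib_left sum_distrib_right by (subst sum.swap) (simp add: mult.assoc)
  also have "\<dots> = (\<Sum>l<n. if l = j then A i l else 0)"
    by (rule sum.cong) (use orthonormal_complete[OF ou] assms in auto)
  finally show ?thesis using assms(3) by simp
qed

text \<open>In the spectral decomposition only nonzero eigenvalues contribute, and the square roots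
  of these scale the eigenvectors into Gram vectors. The rank enters through an independent family
  of kernel vectors \<open>z q\<close>, which bounds the number of nonzero eigenvalues by
  \<open>n - card Q\<close>.\<close>

lemma psd_gram:
  fixes N :: "nat \<Rightarrow> nat \<Rightarrow> complex" and Q :: "nat set"
  assumes herm: "\<And>i j. i < n \<Longrightarrow> j < n \<Longrightarrow> N i j = cnj (N j i)"
    and psd: "\<And>x. 0 \<le> Re (\<Sum>i<n. cnj (x i) * (\<Sum>j<n. N i j * x j))"
    and Q: "finite Q"
    and ker: "\<And>q i. q \<in> Q \<Longrightarrow> i < n \<Longrightarrow> (\<Sum>j<n. N i j * z q j) = 0"
    and indep: "\<And>y. (\<And>i. i < n \<Longrightarrow> (\<Sum>q\<in>Q. y q * z q i) = 0) \<Longrightarrow> \<forall>q\<in>Q. y q = 0"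
  shows "\<exists>d W. d \<le> n - card Q \<and> (\<forall>i<n. \<forall>j<n. (\<Sum>e<d. cnj (W i e) * W j e) = N i j)"
proof -
  obtain w lam where eb: "eigenbasis n n N w lam" using eigenbasis_exists[of n N, OF herm] by blast
  then have ow: "orthonormal n n w"
    and eig: "\<And>k i. k < n \<Longrightarrow> i < n \<Longrightarrow> (\<Sum>j<n. N i j * w k j) = of_real (lam k) * w k i"
    by (auto simp: eigenbasis_def)
  have nonneg: "lam k \<ge> 0" if "k < n" for k
  proof -
    have "(\<Sum>i<n. cnj (w k i) * (\<Sum>j<n. N i j * w k j)) = of_real (lam k) * (\<Sum>i<n. cnj (w k i) * w k i)"
      using eig[OF that] by (simp add: sum_distrib_left mult.left_commute)
    also have "\<dots> = of_real (lam k)" using ow that by (simp add: orthonormal_def)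
    finally show ?thesis using psd[of "w k"] by simp
  qed
  define P where "P = {k. k < n \<and> lam k \<noteq> 0}"
  define Z where "Z = {k. k < n \<and> lam k = 0}"
  have fin: "finite P" "finite Z" by (auto simp: P_def Z_def)
  have "card P + card Z = card (P \<union> Z)"
    using fin by (subst card_Un_disjoint) (auto simp: P_def Z_def)
  also have "P \<union> Z = {..<n}" by (auto simp: P_def Z_def)
  finally have cardPZ: "card P + card Z = n" by simp
  \<comment> \<open>Otherwise some nontrivial combination of the \<open>z q\<close> is orthogonal to
    all null eigenvectors. Lying in the kernel, it is orthogonal to the other eigenvectors too, so
    it is zero, against independence.\<close>
  have "card Q \<le> card Z"
  proof (rule ccontr)
    assume "\<not> ?thesis"
    then have lt: "card Z < card Q" by simp
    obtain h where h: "bij_betw h {..<card Z} Z"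
      using ex_bij_betw_nat_finite[OF fin(2)] by (auto simp: atLeast0LessThan)
    obtain y where y: "\<exists>q\<in>Q. y q \<noteq> 0"
      "\<forall>i<card Z. (\<Sum>q\<in>Q. (\<Sum>j<n. cnj (w (h i) j) * z q j) * y q) = 0"
      using homogeneous_system_nontrivial[OF Q lt, of "\<lambda>i q. \<Sum>j<n. cnj (w (h i) j) * z q j"]
      by auto
    define v where "v = (\<lambda>i. \<Sum>q\<in>Q. y q * z q i)"
    have Nv: "(\<Sum>j<n. N i j * v j) = 0" if "i < n" for i
    proof -
      have "(\<Sum>j<n. N i j * v j) = (\<Sum>q\<in>Q. y q * (\<Sum>j<n. N i j * z q j))"
        unfolding v_def sum_distrib_left by (subst sum.swap) (simp add: mult.left_commute)
      then show ?thesis using ker that by simp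
    qed
    have wv: "(\<Sum>j<n. cnj (w k j) * v j) = 0" if k: "k < n" for k
    proof (cases "lam k = 0")
      case True
      then have "k \<in> Z" using k by (simp add: Z_def)
      then obtain i where i: "i < card Z" "h i = k"
        using h by (metis bij_betw_imp_surj_on imageE lessThan_iff)
      have "(\<Sum>j<n. cnj (w k j) * v j) = (\<Sum>q\<in>Q. (\<Sum>j<n. cnj (w k j) * z q j) * y q)"
        unfolding v_def sum_distrib_left sum_distrib_right
        by (subst sum.swap) (simp add: mult_ac)
      then show ?thesis using y(2) i by auto
    next
      case False
      have "0 = (\<Sum>i<n. cnj (w k i) * (\<Sum>j<n. N i j * v j))" using Nv by simp
      also have "\<dots> = (\<Sum>j<n. cnj (\<Sum>i<n. N j i * w k i) * v j)"
        by (rule hermitian_form_swap[OF herm])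
      also have "\<dots> = of_real (lam k) * (\<Sum>j<n. cnj (w k j) * v j)"
        using eig[OF k] by (simp add: sum_distrib_left mult.assoc)
      finally show ?thesis using False by simp
    qed
    have "v i = 0" if "i < n" for i
      using orthonormal_eqI[OF ow that, of v "\<lambda>_. 0"] wv by simp
    then have "\<forall>q\<in>Q. y q = 0" by (intro indep) (simp add: v_def)
    with y(1) show False by blast
  qed
  then have d: "card P \<le> n - card Q" using cardPZ by simp
  obtain h where h: "bij_betw h {..<card P} P"
    using ex_bij_betw_nat_finite[OF fin(1)] by (auto simp: atLeast0LessThan)
  \<comment> \<open>The conjugate makes the Gram entry at (i, j) equal to \<open>N i j\<close> and
    not to its transpose.\<close>
  define W where "W = (\<lambda>i e. of_real (sqrt (lam (h e))) * cnj (w (h e) i))"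
  have "(\<Sum>e<card P. cnj (W i e) * W j e) = N i j" if ij: "i < n" "j < n" for i j
  proof -
    have "cnj (W i e) * W j e = of_real (lam (h e)) * w (h e) i * cnj (w (h e) j)"
      if "e < card P" for e
    proof -
      have "h e \<in> P" using h that by (auto simp: bij_betw_def)
      then have "of_real (sqrt (lam (h e))) * of_real (sqrt (lam (h e))) = (of_real (lam (h e)) :: complex)"
        unfolding of_real_mult[symmetric] using nonneg by (simp add: P_def)
      moreover have "cnj (W i e) * W j e
          = (of_real (sqrt (lam (h e))) * of_real (sqrt (lam (h e)))) * w (h e) i * cnj (w (h e) j)"
        by (simp add: W_def)
      ultimately show ?thesis by simp
    qed
    then have "(\<Sum>e<card P. cnj (W i e) * W j e)
        = (\<Sum>e<card P. of_real (lam (h e)) * w (h e) i * cnj (w (h e) j))" by simp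
    also have "\<dots> = (\<Sum>k\<in>P. of_real (lam k) * w k i * cnj (w k j))"
      by (rule sum.reindex_bij_betw[OF h])
    also have "\<dots> = (\<Sum>k<n. of_real (lam k) * w k i * cnj (w k j))"
      by (rule sum.mono_neutral_left) (auto simp: P_def)
    finally show ?thesis using eigenbasis_spectral[OF eb ij] by simp
  qed
  with d show ?thesis by blast
qed

section \<open>Diagonal plus rank one operators\<close>

lemma weighted_Cauchy_Schwarz:
  fixes g x :: "'a \<Rightarrow> complex" and r :: "'a \<Rightarrow> real"
  assumes "\<And>k. k \<in> I \<Longrightarrow> r k > 0"
  shows "(cmod (\<Sum>k\<in>I. cnj (g k) * x k))\<^sup>2
    \<le> (\<Sum>k\<in>I. (cmod (g k))\<^sup>2 / r k) * (\<Sum>k\<in>I. r k * (cmod (x k))\<^sup>2)"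
proof -
  let ?f = "\<lambda>k. cmod (g k) / sqrt (r k)" and ?h = "\<lambda>k. sqrt (r k) * cmod (x k)"
  have "cmod (\<Sum>k\<in>I. cnj (g k) * x k) \<le> (\<Sum>k\<in>I. \<bar>?f k\<bar> * \<bar>?h k\<bar>)"
    by (rule order_trans[OF norm_sum], rule sum_mono)
      (use assms in \<open>auto simp: norm_mult abs_mult less_imp_neq[symmetric] real_sqrt_gt_zero\<close>)
  also have "\<dots> \<le> L2_set ?f I * L2_set ?h I" by (rule L2_set_mult_ineq)
  finally have "(cmod (\<Sum>k\<in>I. cnj (g k) * x k))\<^sup>2 \<le> (L2_set ?f I * L2_set ?h I)\<^sup>2"
    by (rule power_mono) simp
  also have "\<dots> = (\<Sum>k\<in>I. (?f k)\<^sup>2) * (\<Sum>k\<in>I. (?h k)\<^sup>2)"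
    by (simp add: power_mult_distrib L2_set_def sum_nonneg)
  also have "(\<Sum>k\<in>I. (?f k)\<^sup>2) = (\<Sum>k\<in>I. (cmod (g k))\<^sup>2 / r k)"
    by (rule sum.cong) (use assms in \<open>auto simp: power_divide less_imp_le\<close>)
  also have "(\<Sum>k\<in>I. (?h k)\<^sup>2) = (\<Sum>k\<in>I. r k * (cmod (x k))\<^sup>2)"
    by (rule sum.cong) (use assms in \<open>auto simp: power_mult_distrib less_imp_le\<close>)
  finally show ?thesis .
qed

text \<open>The matrix problem in eigenbasis coordinates: \<open>\<mu>\<close> lists the eigenvalues
  with multiplicity, in no particular order, and \<open>g\<close> stands for the coordinates of the
  all-ones vector, so that J becomes \<open>g g\<^sup>*\<close>.\<close>

locale diag_plus_rank_one =
  fixes n :: nat and \<mu> :: "nat \<Rightarrow> real" and g :: "nat \<Rightarrow> complex"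
begin

text \<open>\<open>psd\<close> and \<open>ker\<close> refer to the operator \<open>diag \<mu> - \<theta> I + c g g\<^sup>*\<close>.\<close>
definition psd :: "real \<Rightarrow> real \<Rightarrow> bool" where
  "psd \<theta> c \<longleftrightarrow> (\<forall>x. 0 \<le> (\<Sum>k<n. (\<mu> k - \<theta>) * (cmod (x k))\<^sup>2)
     + c * (cmod (\<Sum>k<n. cnj (g k) * x k))\<^sup>2)"

definition ker :: "real \<Rightarrow> real \<Rightarrow> (nat \<Rightarrow> complex) \<Rightarrow> bool" where
  "ker \<theta> c x \<longleftrightarrow> (\<forall>k<n. of_real (\<mu> k - \<theta>) * x k
     + of_real c * g k * (\<Sum>l<n. cnj (g l) * x l) = 0)"

definition K :: "real \<Rightarrow> nat set" where
  "K \<theta> = {k. k < n \<and> \<mu> k = \<theta>}"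

text \<open>Indices in \<open>K \<theta>\<close> contribute \<open>x / 0 = 0\<close>.\<close>
definition C :: "real \<Rightarrow> real" where
  "C \<theta> = (\<Sum>k<n. (cmod (g k))\<^sup>2 / (\<mu> k - \<theta>))"

text \<open>States that the operator has rank at most \<open>d\<close>, tested on coordinate subspaces only: each one
  meeting the kernel trivially has dimension at most \<open>d\<close>.\<close>
definition rank_le :: "nat \<Rightarrow> real \<Rightarrow> real \<Rightarrow> bool" where
  "rank_le d \<theta> c \<longleftrightarrow> (\<forall>R\<subseteq>{..<n}.
     (\<forall>x. (\<forall>k. k \<notin> R \<longrightarrow> x k = 0) \<and> ker \<theta> c x \<longrightarrow> (\<forall>k\<in>R. x k = 0)) \<longrightarrow> card R \<le> d)"

lemma K_simps [simp]: "finite (K \<theta>)" "K \<theta> \<subseteq> {..<n}"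
  by (auto simp: K_def)

section \<open>Necessary conditions for semidefiniteness\<close>

lemma psdD: "psd \<theta> c \<Longrightarrow> 0 \<le> (\<Sum>k<n. (\<mu> k - \<theta>) * (cmod (x k))\<^sup>2)
     + c * (cmod (\<Sum>k<n. cnj (g k) * x k))\<^sup>2"
  by (simp add: psd_def)

text \<open>On the k-th coordinate vector the diagonal part is negative, so the rank one term has to
  compensate.\<close>

lemma psd_below:
  assumes "psd \<theta> c" "k < n" "\<mu> k < \<theta>"
  shows "g k \<noteq> 0" "c > 0"
proof -
  let ?x = "\<lambda>l. if l = k then 1 else 0 :: complex"
  have "(\<Sum>l<n. (\<mu> l - \<theta>) * (cmod (?x l))\<^sup>2) = (\<Sum>l<n. if l = k then \<mu> l - \<theta> else 0)"
    by (rule sum.cong) auto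
  moreover have "(\<Sum>l<n. cnj (g l) * ?x l) = (\<Sum>l<n. if l = k then cnj (g l) else 0)"
    by (rule sum.cong) auto
  ultimately have "c * (cmod (g k))\<^sup>2 > 0"
    using psdD[OF assms(1), of ?x] assms(2,3) by simp
  then show "g k \<noteq> 0" "c > 0" by (auto simp: zero_less_mult_iff)
qed

lemma sum_two:
  fixes f :: "nat \<Rightarrow> 'b::comm_monoid_add"
  assumes "k < n" "l < n" "k \<noteq> l" "\<And>i. i \<noteq> k \<Longrightarrow> i \<noteq> l \<Longrightarrow> f i = 0"
  shows "(\<Sum>i<n. f i) = f k + f l"
proof -
  have "(\<Sum>i<n. f i) = (\<Sum>i\<in>{k, l}. f i)"
    by (rule sum.mono_neutral_right) (use assms in auto)
  then show ?thesis using assms(3) by simp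
qed

text \<open>The plane of the coordinates k and l contains a vector orthogonal to g. There the rank
  one term vanishes and only two nonpositive terms remain, both of which must be zero.\<close>

lemma psd_below_unique:
  assumes "psd \<theta> c" "k < n" "l < n" "k \<noteq> l" "\<mu> k < \<theta>" "\<mu> l \<le> \<theta>"
  shows "\<mu> l = \<theta>" "g l = 0"
proof -
  let ?x = "\<lambda>i. if i = k then cnj (g l) else if i = l then - cnj (g k) else 0"
  have "(\<Sum>i<n. (\<mu> i - \<theta>) * (cmod (?x i))\<^sup>2)
      = (\<mu> k - \<theta>) * (cmod (g l))\<^sup>2 + (\<mu> l - \<theta>) * (cmod (g k))\<^sup>2"
    by (subst sum_two[of k l]) (use assms in auto)
  moreover have "(\<Sum>i<n. cnj (g i) * ?x i) = 0"
    by (subst sum_two[of k l]) (use assms in \<open>auto simp: mult.commute\<close>)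
  ultimately have ge: "0 \<le> (\<mu> k - \<theta>) * (cmod (g l))\<^sup>2 + (\<mu> l - \<theta>) * (cmod (g k))\<^sup>2"
    using psdD[OF assms(1), of ?x] by simp
  have gk: "(cmod (g k))\<^sup>2 > 0" using psd_below[OF assms(1,2,5)] by simp
  have 1: "(\<mu> k - \<theta>) * (cmod (g l))\<^sup>2 \<le> 0" "(\<mu> l - \<theta>) * (cmod (g k))\<^sup>2 \<le> 0"
    using assms by (auto simp: mult_le_0_iff)
  with ge have "(\<mu> k - \<theta>) * (cmod (g l))\<^sup>2 = 0" "(\<mu> l - \<theta>) * (cmod (g k))\<^sup>2 = 0" by linarith+
  then show "\<mu> l = \<theta>" "g l = 0" using gk assms(5) by auto
qed

lemma sum_off_K:
  fixes f :: "nat \<Rightarrow> 'b::comm_monoid_add"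
  assumes "\<And>k. k \<in> K \<theta> \<Longrightarrow> f k = 0"
  shows "(\<Sum>k<n. f k) = (\<Sum>k\<in>{..<n} - K \<theta>. f k)"
  by (rule sum.mono_neutral_right) (use assms in auto)

lemma sum_off_K_remove:
  fixes f :: "nat \<Rightarrow> 'b::comm_monoid_add"
  assumes "\<And>k. k \<in> K \<theta> \<Longrightarrow> f k = 0" "k0 < n" "k0 \<notin> K \<theta>"
  shows "(\<Sum>k<n. f k) = f k0 + (\<Sum>k\<in>{..<n} - K \<theta> - {k0}. f k)"
proof -
  have "(\<Sum>k<n. f k) = (\<Sum>k\<in>{..<n} - K \<theta>. f k)" by (rule sum_off_K) (rule assms(1))
  also have "\<dots> = f k0 + (\<Sum>k\<in>{..<n} - K \<theta> - {k0}. f k)"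
    by (rule sum.remove) (use assms in auto)
  finally show ?thesis .
qed

text \<open>The form is restricted to a plane: g k / (\<mu> k - \<theta>) is scaled by
  \<open>r0\<close> at the one entry below \<theta> and by \<open>r\<close> elsewhere. With
  \<open>C \<theta> = D - A\<close> split accordingly, \<open>key\<close> is the restricted form,
  and suitable \<open>r0\<close>, \<open>r\<close> make it negative whenever
  \<open>D \<ge> A\<close>.\<close>

lemma C_neg:
  assumes psd: "psd \<theta> c" and k0: "k0 < n" "\<mu> k0 < \<theta>"
  shows "C \<theta> < 0"
proof (rule ccontr)
  assume Cn: "\<not> C \<theta> < 0"
  have ge: "\<mu> k \<ge> \<theta>" "k \<in> K \<theta> \<Longrightarrow> g k = 0" if "k < n" "k \<noteq> k0" for k
    using psd_below_unique[OF psd k0(1) that(1)] k0(2) that by (force simp: K_def)+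
  have g0: "g k = 0" if "k \<in> K \<theta>" for k
    using ge(2)[of k] that k0(2) by (auto simp: K_def)
  have k0K: "k0 \<notin> K \<theta>" using k0 by (auto simp: K_def)
  have c: "c > 0" "g k0 \<noteq> 0" using psd_below[OF psd k0] by auto
  let ?I = "{..<n} - K \<theta> - {k0}"
  define D where "D = (\<Sum>k\<in>?I. (cmod (g k))\<^sup>2 / (\<mu> k - \<theta>))"
  define A where "A = (cmod (g k0))\<^sup>2 / (\<theta> - \<mu> k0)"
  have A: "A > 0" using c k0 by (simp add: A_def)
  have A': "(cmod (g k0))\<^sup>2 / (\<mu> k0 - \<theta>) = - A"
    by (simp add: A_def minus_divide_right)
  have "C \<theta> = - A + D" unfolding C_def D_def
    by (subst sum_off_K_remove[of \<theta> _ k0]) (use k0 k0K g0 in \<open>auto simp: A'\<close>)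
  then have DA: "D \<ge> A" using Cn by simp
  have key: "0 \<le> - r0\<^sup>2 * A + r\<^sup>2 * D + c * (r * D - r0 * A)\<^sup>2" for r0 r
  proof -
    define x where "x = (\<lambda>k. of_real (if k = k0 then r0 else r) * g k / of_real (\<mu> k - \<theta>))"
    have x2: "(\<mu> k - \<theta>) * (cmod (x k))\<^sup>2 = (if k = k0 then r0 else r)\<^sup>2 * ((cmod (g k))\<^sup>2 / (\<mu> k - \<theta>))" for k
      by (cases "\<mu> k = \<theta>")
        (simp_all add: x_def norm_mult norm_divide power_mult_distrib power_divide power2_eq_square
          del: of_real_diff)
    have xg: "cnj (g k) * x k = of_real ((if k = k0 then r0 else r) * ((cmod (g k))\<^sup>2 / (\<mu> k - \<theta>)))" for k
      unfolding x_def of_real_mult of_real_divide complex_norm_square by simp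
    have "(\<Sum>k<n. (\<mu> k - \<theta>) * (cmod (x k))\<^sup>2) = - r0\<^sup>2 * A + r\<^sup>2 * D"
      unfolding x2 D_def sum_distrib_left
      by (subst sum_off_K_remove[of \<theta> _ k0]) (use k0 k0K g0 in \<open>auto simp: A'\<close>)
    moreover have "(\<Sum>k<n. cnj (g k) * x k) = of_real (r * D - r0 * A)"
    proof -
      have "(\<Sum>k<n. (if k = k0 then r0 else r) * ((cmod (g k))\<^sup>2 / (\<mu> k - \<theta>))) = r * D - r0 * A"
        unfolding D_def sum_distrib_left
        by (subst sum_off_K_remove[of \<theta> _ k0]) (use k0 k0K g0 in \<open>auto simp: A'\<close>)
      then show ?thesis unfolding xg of_real_sum[symmetric] by simp
    qed
    ultimately show ?thesis using psdD[OF psd, of x] by (simp del: of_real_diff of_real_mult)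
  qed
  show False
  proof (cases "D > A")
    case True
    \<comment> \<open>The choice \<open>r0 = D\<close>, \<open>r = A\<close> makes the rank one term
      vanish.\<close>
    have "- D\<^sup>2 * A + A\<^sup>2 * D + c * (A * D - D * A)\<^sup>2 = - (D * A * (D - A))"
      by (simp add: power2_eq_square algebra_simps)
    moreover have "D * A * (D - A) > 0" using True A by simp
    ultimately show False using key[of D A] by linarith
  next
    case False
    then have "D = A" using DA by simp
    \<comment> \<open>At equality the vector with \<open>r0 = r = 1\<close> only gives 0. Moving
      \<open>r0\<close> to \<open>1 + \<epsilon>\<close> lowers the form to first order, and this
      \<epsilon> is small enough for the quadratic term with factor \<open>c\<close> not to undo
      it.\<close>
    define \<epsilon> where "\<epsilon> = 1 / (1 + c * A)"
    have cA: "1 + c * A > 0" using c A by (simp add: add_pos_pos)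
    have e: "\<epsilon> > 0" "\<epsilon> * (1 + c * A) = 1" using cA by (auto simp: \<epsilon>_def)
    have "- (1 + \<epsilon>)\<^sup>2 * A + 1\<^sup>2 * A + c * (1 * A - (1 + \<epsilon>) * A)\<^sup>2
        = A * \<epsilon> * (\<epsilon> * (1 + c * A) - 2 * \<epsilon> - 2)"
      by (simp add: power2_eq_square algebra_simps)
    also have "\<dots> = - (A * \<epsilon> * (1 + 2 * \<epsilon>))" unfolding e(2) by (simp add: algebra_simps)
    also have "\<dots> < 0" using A e by simp
    finally show False using key[of "1 + \<epsilon>" 1] \<open>D = A\<close> by simp
  qed
qed

section \<open>Values of c that make the form semidefinite\<close>

lemma psd_0:
  assumes "\<And>k. k < n \<Longrightarrow> \<theta> \<le> \<mu> k"
  shows "psd \<theta> 0"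
  unfolding psd_def using assms by (auto intro!: sum_nonneg)

text \<open>Cauchy-Schwarz with weights \<mu> k - \<theta> bounds the squared inner product with g
  by \<open>C \<theta>\<close> times the diagonal form.\<close>

lemma psd_neg:
  assumes ge: "\<And>k. k < n \<Longrightarrow> \<theta> \<le> \<mu> k" and g0: "\<And>k. k \<in> K \<theta> \<Longrightarrow> g k = 0" and C: "C \<theta> > 0"
  shows "psd \<theta> (- 1 / C \<theta>)"
  unfolding psd_def
proof
  fix x
  let ?I = "{..<n} - K \<theta>"
  have "(cmod (\<Sum>k<n. cnj (g k) * x k))\<^sup>2 = (cmod (\<Sum>k\<in>?I. cnj (g k) * x k))\<^sup>2"
    by (subst sum_off_K[of \<theta>]) (use g0 in auto)
  also have "\<dots> \<le> (\<Sum>k\<in>?I. (cmod (g k))\<^sup>2 / (\<mu> k - \<theta>)) * (\<Sum>k\<in>?I. (\<mu> k - \<theta>) * (cmod (x k))\<^sup>2)"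
    by (rule weighted_Cauchy_Schwarz) (use ge in \<open>force simp: K_def\<close>)
  also have "(\<Sum>k\<in>?I. (cmod (g k))\<^sup>2 / (\<mu> k - \<theta>)) = C \<theta>"
    unfolding C_def by (subst sum_off_K[of \<theta>]) (use g0 in auto)
  also have "(\<Sum>k\<in>?I. (\<mu> k - \<theta>) * (cmod (x k))\<^sup>2) = (\<Sum>k<n. (\<mu> k - \<theta>) * (cmod (x k))\<^sup>2)"
    by (rule sum_off_K[symmetric]) (simp add: K_def)
  finally show "0 \<le> (\<Sum>k<n. (\<mu> k - \<theta>) * (cmod (x k))\<^sup>2)
     + - 1 / C \<theta> * (cmod (\<Sum>k<n. cnj (g k) * x k))\<^sup>2"
    using C by (simp add: field_simps)
qed

text \<open>A reversed Cauchy-Schwarz inequality for a diagonal form with a single negative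
  direction \<open>k0\<close>. With \<open>C \<theta> = - E\<close> the claim is
  \<open>\<nu> * (cmod (x k0))\<^sup>2 \<le> T\<close>; solving
  \<open>s = cnj (g k0) * x k0 + r\<close> for the k0 term reduces it to a bound on \<open>s\<close>
  and \<open>r\<close>.\<close>

lemma psd_pos:
  assumes k0: "k0 < n" "\<mu> k0 < \<theta>"
    and ge: "\<And>k. k < n \<Longrightarrow> k \<noteq> k0 \<Longrightarrow> \<theta> \<le> \<mu> k"
    and g0: "\<And>k. k \<in> K \<theta> \<Longrightarrow> g k = 0" and C: "C \<theta> < 0"
  shows "psd \<theta> (- 1 / C \<theta>)"
  unfolding psd_def
proof
  fix x
  let ?I = "{..<n} - K \<theta> - {k0}"
  have k0K: "k0 \<notin> K \<theta>" using k0 by (auto simp: K_def)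
  define D where "D = (\<Sum>k\<in>?I. (cmod (g k))\<^sup>2 / (\<mu> k - \<theta>))"
  define P where "P = (\<Sum>k\<in>?I. (\<mu> k - \<theta>) * (cmod (x k))\<^sup>2)"
  define \<nu> where "\<nu> = \<theta> - \<mu> k0"
  define A where "A = (cmod (g k0))\<^sup>2 / \<nu>"
  define E where "E = A - D"
  define r where "r = (\<Sum>k\<in>?I. cnj (g k) * x k)"
  define s where "s = (\<Sum>k<n. cnj (g k) * x k)"
  have \<nu>: "\<nu> > 0" using k0 by (simp add: \<nu>_def)
  have pos: "\<mu> k - \<theta> > 0" if "k \<in> ?I" for k using ge[of k] that by (force simp: K_def)
  have D: "D \<ge> 0" unfolding D_def using pos by (intro sum_nonneg divide_nonneg_pos) auto
  have P: "P \<ge> 0" unfolding P_def using pos by (intro sum_nonneg mult_nonneg_nonneg) (auto intro: less_imp_le)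
  have A': "(cmod (g k0))\<^sup>2 / (\<mu> k0 - \<theta>) = - A"
    by (simp add: A_def \<nu>_def minus_divide_right)
  have CE: "C \<theta> = - E" unfolding C_def D_def E_def
    by (subst sum_off_K_remove[of \<theta> _ k0]) (use k0 k0K g0 in \<open>auto simp: A'\<close>)
  then have E: "E > 0" using C by simp
  have A: "A > 0" using E D by (simp add: E_def)
  have rDP: "(cmod r)\<^sup>2 \<le> D * P" unfolding r_def D_def P_def
    by (rule weighted_Cauchy_Schwarz) (rule pos)
  have s: "s = cnj (g k0) * x k0 + r" unfolding s_def r_def
    by (subst sum_off_K_remove[of \<theta> _ k0]) (use k0 k0K g0 in auto)
  have q: "(\<Sum>k<n. (\<mu> k - \<theta>) * (cmod (x k))\<^sup>2) = - \<nu> * (cmod (x k0))\<^sup>2 + P" unfolding P_def \<nu>_def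
    by (subst sum_off_K_remove[of \<theta> _ k0]) (use k0 k0K in \<open>auto simp: K_def\<close>)
  define T where "T = (cmod s)\<^sup>2 / E + P"
  \<comment> \<open>\<open>U\<close> is the cross term in the expansion of
    \<open>(E + D) * T = A * T\<close>. It dominates \<open>2 * (cmod s * cmod r)\<close> by the
    arithmetic-geometric mean inequality, since \<open>(cmod r)\<^sup>2 \<le> D * P\<close>.\<close>
  define U where "U = D * ((cmod s)\<^sup>2 / E) + E * P"
  have "2 * (cmod s * cmod r) \<le> U"
  proof (rule power2_le_imp_le)
    show "U \<ge> 0" using D P E by (simp add: U_def)
    have "(2 * (cmod s * cmod r))\<^sup>2 = 4 * (cmod s)\<^sup>2 * (cmod r)\<^sup>2" by (simp add: power_mult_distrib)
    also have "\<dots> \<le> 4 * (cmod s)\<^sup>2 * (D * P)" using rDP by (intro mult_left_mono) auto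
    also have "\<dots> = 4 * (D * ((cmod s)\<^sup>2 / E)) * (E * P)" using E by simp
    also have "\<dots> \<le> U\<^sup>2"
    proof -
      have "4 * a * b \<le> (a + b)\<^sup>2" for a b :: real
        using zero_le_power2[of "a - b"] by (simp add: power2_eq_square algebra_simps)
      then show ?thesis unfolding U_def .
    qed
    finally show "(2 * (cmod s * cmod r))\<^sup>2 \<le> U\<^sup>2" .
  qed
  moreover have "E * T = (cmod s)\<^sup>2 + E * P" using E by (simp add: T_def field_simps)
  moreover have "D * T = D * ((cmod s)\<^sup>2 / E) + D * P" by (simp add: T_def algebra_simps)
  moreover have "A * T = E * T + D * T" by (simp add: E_def algebra_simps)
  ultimately have bound: "(cmod s + cmod r)\<^sup>2 \<le> A * T"
    using rDP by (simp add: power2_sum U_def)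
  have "cmod (cnj (g k0) * x k0) \<le> cmod s + cmod r"
    using norm_triangle_ineq4[of s r] s by simp
  then have "(cmod (cnj (g k0) * x k0))\<^sup>2 \<le> (cmod s + cmod r)\<^sup>2" by (rule power_mono) simp
  moreover have "(cmod (cnj (g k0) * x k0))\<^sup>2 = A * (\<nu> * (cmod (x k0))\<^sup>2)"
    using \<nu> by (simp add: A_def norm_mult power_mult_distrib)
  ultimately have "A * (\<nu> * (cmod (x k0))\<^sup>2) \<le> A * T" using bound by linarith
  then have "\<nu> * (cmod (x k0))\<^sup>2 \<le> T" using A by simp
  then show "0 \<le> (\<Sum>k<n. (\<mu> k - \<theta>) * (cmod (x k))\<^sup>2)
     + - 1 / C \<theta> * (cmod (\<Sum>k<n. cnj (g k) * x k))\<^sup>2"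
    unfolding q CE s_def[symmetric] by (simp add: T_def)
qed

section \<open>Kernel vectors and lower bounds for the rank\<close>

lemma ker_K:
  assumes "k \<in> K \<theta>" "g k = 0 \<or> c = 0"
  shows "ker \<theta> c (\<lambda>i. if i = k then 1 else 0)"
proof -
  have "(\<Sum>l<n. cnj (g l) * (if l = k then 1 else 0)) = cnj (g k)"
    using assms by (simp add: if_distrib cong: if_cong) (auto simp: K_def)
  then show ?thesis using assms by (auto simp: ker_def K_def)
qed

text \<open>The diagonal part maps this vector to g, and its inner product with g is
  \<open>C \<theta>\<close>, so the rank one part maps it to - g. On \<open>K \<theta>\<close> both
  contributions vanish with g.\<close>

lemma ker_C:
  assumes g0: "\<And>k. k \<in> K \<theta> \<Longrightarrow> g k = 0" and C: "C \<theta> \<noteq> 0"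
  shows "ker \<theta> (- 1 / C \<theta>) (\<lambda>k. g k / of_real (\<mu> k - \<theta>))"
proof -
  have "(\<Sum>l<n. cnj (g l) * (g l / of_real (\<mu> l - \<theta>))) = of_real (C \<theta>)"
    unfolding C_def of_real_sum of_real_divide complex_norm_square
    by (intro sum.cong refl) simp
  then show ?thesis using g0 C by (auto simp: ker_def K_def)
qed

lemma rank_le_D:
  assumes "rank_le d \<theta> c" "R \<subseteq> {..<n}"
    "\<And>x. (\<And>k. k \<notin> R \<Longrightarrow> x k = 0) \<Longrightarrow> ker \<theta> c x \<Longrightarrow> \<forall>k\<in>R. x k = 0"
  shows "card R \<le> d"
  using assms unfolding rank_le_def by blast

lemma card_off_K: "card ({..<n} - K \<theta>) = n - card (K \<theta>)"
  by (simp add: card_Diff_subset)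

text \<open>For a kernel vector with \<open>x k0 = 0\<close>, row \<open>k0\<close> says that the
  rank one term vanishes. The other rows are then diagonal and determine their unknowns off
  \<open>K \<theta>\<close>.\<close>

lemma rank_ge_generic:
  assumes "rank_le d \<theta> c" "k0 < n" "k0 \<notin> K \<theta>" "g k0 \<noteq> 0"
  shows "n - card (K \<theta>) - 1 \<le> d"
proof -
  have "card ({..<n} - K \<theta> - {k0}) \<le> d"
  proof (rule rank_le_D[OF assms(1)])
    fix x assume x: "\<And>k. k \<notin> {..<n} - K \<theta> - {k0} \<Longrightarrow> x k = 0" and k: "ker \<theta> c x"
    then have "of_real c * (\<Sum>l<n. cnj (g l) * x l) = 0"
      using assms(2,4) x[of k0] by (auto simp: ker_def)
    then have "of_real (\<mu> k - \<theta>) * x k = 0" if "k < n" for k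
      using k that unfolding ker_def by (metis (no_types, lifting) add_0_right mult.assoc mult.commute mult_zero_left)
    then show "\<forall>k\<in>{..<n} - K \<theta> - {k0}. x k = 0" by (auto simp: K_def)
  qed auto
  then show ?thesis using assms(2,3) card_off_K by (simp add: card_Diff_singleton)
qed

text \<open>Off \<open>K \<theta>\<close> a kernel vector is - c s g k / (\<mu> k - \<theta>);
  inserting this into the definition of s gives s (1 + c C) = 0, hence s = 0.\<close>

lemma rank_ge_off_critical:
  assumes "rank_le d \<theta> c" "\<And>k. k \<in> K \<theta> \<Longrightarrow> g k = 0" "c * C \<theta> \<noteq> - 1"
  shows "n - card (K \<theta>) \<le> d"
  unfolding card_off_K[symmetric]
proof (rule rank_le_D[OF assms(1)])
  fix x assume x: "\<And>k. k \<notin> {..<n} - K \<theta> \<Longrightarrow> x k = 0" and k: "ker \<theta> c x"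
  define s where "s = (\<Sum>l<n. cnj (g l) * x l)"
  have xk: "x k = - of_real c * s * (g k / of_real (\<mu> k - \<theta>))" if "k < n" for k
  proof (cases "k \<in> K \<theta>")
    case True then show ?thesis using x[of k] by (simp add: K_def)
  next
    case False
    then have "\<mu> k - \<theta> \<noteq> 0" using that by (simp add: K_def)
    moreover have "of_real (\<mu> k - \<theta>) * x k + of_real c * g k * s = 0"
      using k that by (simp add: ker_def s_def)
    ultimately show ?thesis
      by (simp add: field_simps add_eq_0_iff del: of_real_diff)
  qed
  have "s = (\<Sum>l<n. - of_real c * s * of_real ((cmod (g l))\<^sup>2 / (\<mu> l - \<theta>)))"
    unfolding s_def by (intro sum.cong refl, subst xk)
      (simp_all add: s_def complex_norm_square mult_ac del: of_real_power)
  also have "\<dots> = - of_real c * s * of_real (C \<theta>)"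
    unfolding sum_distrib_left[symmetric] C_def by simp
  finally have s: "s = - of_real c * s * of_real (C \<theta>)" .
  have "s * of_real (1 + c * C \<theta>) = s - (- of_real c * s * of_real (C \<theta>))"
    by (simp add: algebra_simps)
  then have "s * of_real (1 + c * C \<theta>) = 0" using s right_minus_eq by metis
  moreover have "1 + c * C \<theta> \<noteq> 0" using assms(3) by auto
  ultimately have "s = 0" by (simp del: of_real_add of_real_mult)
  then show "\<forall>k\<in>{..<n} - K \<theta>. x k = 0" using xk by simp
qed auto

text \<open>Row \<open>k0\<close> has zero diagonal entry and nonzero g, so it alone forces the rank
  one term to vanish. If \<open>c\<close> is nonzero, the inner product with g itself vanishes, and
  this extra equation controls the coordinate \<open>k0\<close> as well.\<close>

lemma rank_ge_main:
  assumes "rank_le d \<theta> c" "k0 \<in> K \<theta>" "g k0 \<noteq> 0"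
  shows "n - card (K \<theta>) \<le> d" "c \<noteq> 0 \<Longrightarrow> n - card (K \<theta>) < d"
proof -
  have 1: "of_real c * (\<Sum>l<n. cnj (g l) * x l) = 0"
    "\<And>k. k < n \<Longrightarrow> k \<notin> K \<theta> \<Longrightarrow> x k = 0" if k: "ker \<theta> c x" for x
  proof -
    show 0: "of_real c * (\<Sum>l<n. cnj (g l) * x l) = 0"
      using k assms(2,3) by (auto simp: ker_def K_def)
    have "of_real (\<mu> k - \<theta>) * x k = 0" if "k < n" for k
      using k that 0 unfolding ker_def by (metis (no_types, lifting) add_0_right mult.assoc mult.commute mult_zero_left)
    then show "\<And>k. k < n \<Longrightarrow> k \<notin> K \<theta> \<Longrightarrow> x k = 0" by (auto simp: K_def)
  qed
  show "n - card (K \<theta>) \<le> d"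
    unfolding card_off_K[symmetric] by (rule rank_le_D[OF assms(1)]) (use 1 in auto)
  assume c: "c \<noteq> 0"
  have "card (insert k0 ({..<n} - K \<theta>)) \<le> d"
  proof (rule rank_le_D[OF assms(1)])
    show "insert k0 ({..<n} - K \<theta>) \<subseteq> {..<n}" using assms(2) by (auto simp: K_def)
    fix x assume x: "\<And>k. k \<notin> insert k0 ({..<n} - K \<theta>) \<Longrightarrow> x k = 0" and k: "ker \<theta> c x"
    have x0: "x l = 0" if "l < n" "l \<noteq> k0" for l using 1(2)[OF k] x that by blast
    have "(\<Sum>l<n. cnj (g l) * x l) = (\<Sum>l<n. if l = k0 then cnj (g k0) * x k0 else 0)"
      by (rule sum.cong) (auto simp: x0)
    also have "\<dots> = cnj (g k0) * x k0" using assms(2) by (simp add: K_def)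
    finally have "x k0 = 0" using 1(1)[OF k] c assms(3) by simp
    then show "\<forall>k\<in>insert k0 ({..<n} - K \<theta>). x k = 0" using x0 by auto
  qed
  then show "n - card (K \<theta>) < d" using assms(2) by (simp add: card_off_K)
qed

end

section \<open>Main angles and shifted Gram matrices in an eigenbasis\<close>

text \<open>Multiplicities are defined through \<open>dim_gen_eigenspace\<close>, which has a closed
  formula for Jordan matrices; a diagonal matrix is therefore presented with blocks of size
  1.\<close>

lemma jordan_matrix_blocks_1:
  "jordan_matrix (map (\<lambda>a. (1, a)) as)
    = mat (length as) (length as) (\<lambda>(i, j). if i = j then as ! i else 0)"
proof (induction as)
  case Nil
  show ?case by (intro eq_matI) (auto simp: jordan_matrix_def)
next
  case (Cons a as)
  have len: "sum_list (map fst (map (\<lambda>a. (1, a)) as)) = length as"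
    by (induction as) auto
  have "jordan_matrix (map (\<lambda>a. (1, a)) (a # as)) = four_block_mat (jordan_block 1 a)
      (0\<^sub>m 1 (length as)) (0\<^sub>m (length as) 1) (jordan_matrix (map (\<lambda>a. (1, a)) as))"
    using len by (simp add: jordan_matrix_Cons)
  also have "\<dots> = mat (length (a # as)) (length (a # as)) (\<lambda>(i, j). if i = j then (a # as) ! i else 0)"
    unfolding Cons.IH by (intro eq_matI) (auto simp: jordan_block_def nth_Cons')
  finally show ?case .
qed

locale hermitian_eigenbasis =
  fixes n :: nat and M :: "complex mat" and u :: "nat \<Rightarrow> nat \<Rightarrow> complex" and \<mu> :: "nat \<Rightarrow> real"
  assumes M: "M \<in> carrier_mat n n"
    and eb: "eigenbasis n n (\<lambda>i j. M $$ (i, j)) u \<mu>"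
begin

definition coef :: "nat \<Rightarrow> (nat \<Rightarrow> complex) \<Rightarrow> complex" where
  "coef k x = (\<Sum>i<n. cnj (u k i) * x i)"

definition g :: "nat \<Rightarrow> complex" where
  "g k = coef k (\<lambda>_. 1)"

sublocale diag_plus_rank_one n \<mu> g .

lemma ou: "orthonormal n n u"
  using eb by (simp add: eigenbasis_def)

lemma eig: "k < n \<Longrightarrow> i < n \<Longrightarrow> (\<Sum>j<n. M $$ (i, j) * u k j) = of_real (\<mu> k) * u k i"
  using eb by (simp add: eigenbasis_def)

lemma spectral: "i < n \<Longrightarrow> j < n \<Longrightarrow> M $$ (i, j) = (\<Sum>k<n. of_real (\<mu> k) * u k i * cnj (u k j))"
  by (rule eigenbasis_spectral[OF eb])

lemma herm: "M $$ (i, j) = cnj (M $$ (j, i))" if "i < n" "j < n"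
  unfolding spectral[OF that] spectral[OF that(2,1)] by (simp add: mult_ac)

lemma coef_comb:
  assumes "k < n" "L \<subseteq> {..<n}"
  shows "coef k (\<lambda>i. \<Sum>l\<in>L. x l * u l i) = (if k \<in> L then x k else 0)"
proof -
  have fin: "finite L" using assms(2) finite_subset by blast
  have "coef k (\<lambda>i. \<Sum>l\<in>L. x l * u l i) = (\<Sum>l\<in>L. x l * (\<Sum>i<n. cnj (u k i) * u l i))"
    unfolding coef_def sum_distrib_left by (subst sum.swap) (simp add: mult.left_commute)
  also have "\<dots> = (\<Sum>l\<in>L. if l = k then x k else 0)"
    by (intro sum.cong refl) (use ou assms in \<open>auto simp: orthonormal_def\<close>)
  also have "\<dots> = (if k \<in> L then x k else 0)" using fin by simp
  finally show ?thesis .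
qed

lemma expansion: "i < n \<Longrightarrow> x i = (\<Sum>k<n. coef k x * u k i)"
  unfolding coef_def by (rule orthonormal_expansion[OF ou])

lemma coef_eqI: "(\<And>k. k < n \<Longrightarrow> coef k x = coef k y) \<Longrightarrow> i < n \<Longrightarrow> x i = y i"
  unfolding coef_def by (rule orthonormal_eqI[OF ou])

lemma coef_cong: "(\<And>i. i < n \<Longrightarrow> x i = y i) \<Longrightarrow> coef k x = coef k y"
  unfolding coef_def by simp

lemma coef_mult:
  assumes "k < n"
  shows "coef k (\<lambda>i. \<Sum>j<n. M $$ (i, j) * x j) = of_real (\<mu> k) * coef k x"
proof -
  have "coef k (\<lambda>i. \<Sum>j<n. M $$ (i, j) * x j) = (\<Sum>j<n. cnj (\<Sum>i<n. M $$ (j, i) * u k i) * x j)"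
    unfolding coef_def by (rule hermitian_form_swap[OF herm])
  also have "\<dots> = of_real (\<mu> k) * coef k x"
    using eig[OF assms] by (simp add: coef_def sum_distrib_left mult.assoc)
  finally show ?thesis .
qed

lemma parseval: "(\<Sum>i<n. cnj (x i) * y i) = (\<Sum>k<n. cnj (coef k x) * coef k y)"
proof -
  have "(\<Sum>i<n. cnj (x i) * y i) = (\<Sum>i<n. cnj (\<Sum>k<n. coef k x * u k i) * y i)"
    using expansion[of _ x] by (intro sum.cong refl) auto
  also have "\<dots> = (\<Sum>i<n. \<Sum>k<n. cnj (coef k x) * (cnj (u k i) * y i))"
    by (simp add: sum_distrib_right mult.assoc)
  also have "\<dots> = (\<Sum>k<n. cnj (coef k x) * coef k y)"
    unfolding coef_def[of _ y] sum_distrib_left by (rule sum.swap)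
  finally show ?thesis .
qed

lemma mult_vec_index:
  assumes "v \<in> carrier_vec n" "i < n"
  shows "(M *\<^sub>v v) $ i = (\<Sum>j<n. M $$ (i, j) * v $ j)"
  using assms M by (auto simp: scalar_prod_def atLeast0LessThan intro!: sum.cong)

section \<open>Eigenspaces, multiplicities and main angles in coordinates\<close>

lemma eigenspace_iff:
  "v \<in> eigenspace M t \<longleftrightarrow>
    v \<in> carrier_vec n \<and> (\<forall>k<n. of_real (\<mu> k) \<noteq> t \<longrightarrow> coef k (($) v) = 0)"
proof (cases "v \<in> carrier_vec n")
  case True
  have "M *\<^sub>v v = t \<cdot>\<^sub>v v \<longleftrightarrow> (\<forall>i<n. (\<Sum>j<n. M $$ (i, j) * v $ j) = t * v $ i)"
  proof
    assume eq: "M *\<^sub>v v = t \<cdot>\<^sub>v v"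
    show "\<forall>i<n. (\<Sum>j<n. M $$ (i, j) * v $ j) = t * v $ i"
      unfolding mult_vec_index[OF True, symmetric] using eq True
      by (metis carrier_vecD index_smult_vec(1) mult_vec_index[OF True])
  next
    assume "\<forall>i<n. (\<Sum>j<n. M $$ (i, j) * v $ j) = t * v $ i"
    then show "M *\<^sub>v v = t \<cdot>\<^sub>v v"
      using True M by (intro eq_vecI) (auto simp: mult_vec_index[OF True] simp del: index_mult_mat_vec)
  qed
  also have "\<dots> \<longleftrightarrow> (\<forall>k<n. coef k (\<lambda>i. \<Sum>j<n. M $$ (i, j) * v $ j) = coef k (\<lambda>i. t * v $ i))"
    by (intro iffI allI impI, rule coef_cong, blast, rule coef_eqI, auto)
  also have "\<dots> \<longleftrightarrow> (\<forall>k<n. of_real (\<mu> k) \<noteq> t \<longrightarrow> coef k (($) v) = 0)"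
  proof -
    have "coef k (\<lambda>i. t * v $ i) = t * coef k (($) v)" for k
      by (simp add: coef_def sum_distrib_left mult.left_commute)
    then show ?thesis by (auto simp: coef_mult)
  qed
  finally show ?thesis using True M by (simp add: eigenspace_def)
next
  case False
  then show ?thesis using M by (auto simp: eigenspace_def)
qed

lemma coef_u: "k < n \<Longrightarrow> l < n \<Longrightarrow> coef k (u l) = (if k = l then 1 else 0)"
  using ou by (simp add: coef_def orthonormal_def)

lemma coef_vec: "coef k (($) (vec n x)) = coef k x"
  by (rule coef_cong) simp

lemma eigenvalue_iff: "eigenvalue M t \<longleftrightarrow> (\<exists>k<n. t = of_real (\<mu> k))"
proof
  assume "eigenvalue M t"
  then obtain v where v: "v \<in> eigenspace M t" "v \<noteq> 0\<^sub>v n"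
    using M by (auto simp: eigenvalue_def eigenvector_def eigenspace_def)
  show "\<exists>k<n. t = of_real (\<mu> k)"
  proof (rule ccontr)
    assume "\<not> ?thesis"
    then have "coef k (($) v) = coef k (\<lambda>_. 0)" if "k < n" for k
      using v(1) that unfolding eigenspace_iff by (auto simp: coef_def)
    then have "v $ i = 0" if "i < n" for i using coef_eqI that by blast
    then have "v = 0\<^sub>v n" using v(1) unfolding eigenspace_iff by (intro eq_vecI) auto
    with v(2) show False by simp
  qed
next
  assume "\<exists>k<n. t = of_real (\<mu> k)"
  then obtain k where k: "k < n" "t = of_real (\<mu> k)" by blast
  have "vec n (u k) \<in> eigenspace M t"
    unfolding eigenspace_iff coef_vec using k by (auto simp: coef_u)
  moreover have "vec n (u k) \<noteq> 0\<^sub>v n"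
  proof
    assume eq: "vec n (u k) = 0\<^sub>v n"
    have "u k i = 0" if "i < n" for i using arg_cong[OF eq, of "\<lambda>v. v $ i"] that by simp
    then have "coef k (u k) = 0" by (simp add: coef_def)
    then show False using k by (simp add: coef_u)
  qed
  ultimately show "eigenvalue M t" unfolding eigenvalue_def
    using M by (intro exI[of _ "vec n (u k)"]) (auto simp: eigenvector_def eigenspace_def)
qed

lemma eig_list_eq: "eig_list M = sorted_list_of_set (\<mu> ` {..<n})"
proof -
  have "{t. eigenvalue M (of_real t)} = \<mu> ` {..<n}" by (auto simp: eigenvalue_iff)
  then show ?thesis by (simp add: eig_list_def)
qed

lemma eig_mult_eq: "eig_mult M (of_real t) = card (K t)"
proof -
  define P where "P = mat n n (\<lambda>(i, k). u k i)"
  define Q where "Q = mat n n (\<lambda>(k, i). cnj (u k i))"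
  define as where "as = map (\<lambda>k. complex_of_real (\<mu> k)) [0..<n]"
  define D where "D = jordan_matrix (map (\<lambda>a. (1, a)) as)"
  have D: "D = mat n n (\<lambda>(i, j). if i = j then of_real (\<mu> i) else 0)"
    unfolding D_def jordan_matrix_blocks_1 by (intro eq_matI) (auto simp: as_def)
  have c: "P \<in> carrier_mat n n" "Q \<in> carrier_mat n n" "D \<in> carrier_mat n n"
    by (auto simp: P_def Q_def D)
  have QP: "Q * P = 1\<^sub>m n"
    by (rule eq_matI)
      (use ou in \<open>auto simp: P_def Q_def scalar_prod_def orthonormal_def atLeast0LessThan\<close>)
  have PQ: "P * Q = 1\<^sub>m n" by (rule mat_mult_left_right_inverse[OF c(2,1) QP])
  have "P * D = mat n n (\<lambda>(i, k). of_real (\<mu> k) * u k i)"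
  proof (rule eq_matI)
    fix i k assume "i < dim_row (mat n n (\<lambda>(i, k). of_real (\<mu> k) * u k i))"
      "k < dim_col (mat n n (\<lambda>(i, k). of_real (\<mu> k) * u k i))"
    then have ik: "i < n" "k < n" by auto
    have "(P * D) $$ (i, k) = (\<Sum>l<n. u l i * (if l = k then of_real (\<mu> l) else 0))"
      using ik by (simp add: P_def D scalar_prod_def atLeast0LessThan)
    also have "\<dots> = (\<Sum>l<n. if l = k then of_real (\<mu> k) * u k i else 0)"
      by (rule sum.cong) auto
    finally show "(P * D) $$ (i, k) = mat n n (\<lambda>(i, k). of_real (\<mu> k) * u k i) $$ (i, k)"
      using ik by simp
  qed (auto simp: P_def D)
  then have "M = P * D * Q"
    using M by (intro eq_matI) (auto simp: Q_def scalar_prod_def atLeast0LessThan spectral)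
  then have "similar_mat_wit M D P Q"
    using c M PQ QP by (auto simp: similar_mat_wit_def Let_def)
  then have "similar_mat M D" by (auto simp: similar_mat_def)
  then have "eig_mult M (of_real t) = dim_gen_eigenspace D (of_real t) 1"
    unfolding eig_mult_def by (simp add: dim_gen_eigenspace_similar)
  also have "\<dots> = (\<Sum>n\<leftarrow>map fst [(n, e)\<leftarrow>map (\<lambda>a. (1, a)) as. e = complex_of_real t]. min 1 n)"
    unfolding D_def by (rule dim_gen_eigenspace_jordan_matrix)
  also have "\<dots> = length (filter (\<lambda>k. \<mu> k = t) [0..<n])"
    unfolding as_def by (induction n) auto
  also have "\<dots> = card (K t)"
    by (subst distinct_card[symmetric]) (auto simp: K_def intro: arg_cong[of _ _ card])
  finally show ?thesis .
qed

text \<open>A candidate for the projection is pinned down coordinate by coordinate: membership in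
  the eigenspace fixes those with \<mu> k different from t, and orthogonality of the residual to
  \<open>u k\<close> fixes the others.\<close>

lemma eig_proj_eq:
  assumes v: "v \<in> carrier_vec n"
  shows "eig_proj M (of_real t) v = vec n (\<lambda>i. \<Sum>k\<in>K t. coef k (($) v) * u k i)"
    (is "_ = ?p")
proof -
  have cp: "coef k (($) ?p) = (if \<mu> k = t then coef k (($) v) else 0)" if "k < n" for k
    unfolding coef_vec
    using coef_comb[OF that, of "K t" "\<lambda>l. coef l (($) v)"] that K_simps(2)[of t] by (simp add: K_def)
  have minus: "coef k (($) (v - q)) = coef k (($) v) - coef k (($) q)" if "q \<in> carrier_vec n" for k q
    using v that by (simp add: coef_def algebra_simps sum_subtractf)
  have ci: "cinner w x = (\<Sum>k<n. cnj (coef k (($) w)) * coef k (($) x))"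
    if "w \<in> carrier_vec n" for w x
    using that by (simp add: cinner_def parseval[of "($) w" "($) x"])
  show ?thesis unfolding eig_proj_def
  proof (rule the_equality)
    have "?p \<in> eigenspace M (of_real t)" unfolding eigenspace_iff using cp by auto
    moreover have "cinner w (v - ?p) = 0" if "w \<in> eigenspace M (of_real t)" for w
      using that unfolding eigenspace_iff
      by (subst ci) (auto intro!: sum.neutral simp: minus cp)
    ultimately show "?p \<in> eigenspace M (of_real t) \<and>
        (\<forall>w\<in>eigenspace M (of_real t). cinner w (v - ?p) = 0)" by blast
  next
    fix q assume q: "q \<in> eigenspace M (of_real t) \<and>
        (\<forall>w\<in>eigenspace M (of_real t). cinner w (v - q) = 0)"
    then have qc: "q \<in> carrier_vec n" by (simp add: eigenspace_iff)
    have "coef k (($) q) = coef k (($) ?p)" if k: "k < n" for k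
    proof (cases "\<mu> k = t")
      case True
      have "vec n (u k) \<in> eigenspace M (of_real t)"
        unfolding eigenspace_iff coef_vec using k True by (auto simp: coef_u)
      then have "cinner (vec n (u k)) (v - q) = 0" using q by blast
      then have "coef k (($) (v - q)) = 0" by (simp add: cinner_def coef_def)
      then show ?thesis using True qc k by (simp add: minus cp)
    next
      case False
      then show ?thesis using q k by (simp add: eigenspace_iff cp)
    qed
    then have "q $ i = ?p $ i" if "i < n" for i using coef_eqI that by blast
    then show "q = ?p" using qc by (intro eq_vecI) auto
  qed
qed

text \<open>Parseval for the projected all-ones vector. The factor n cancels the normalization of
  the main angle, which explains its presence in the constants of the theorem.\<close>

lemma main_angle_sq:
  assumes "n > 0"
  shows "real n * (main_angle M (of_real t))\<^sup>2 = (\<Sum>k\<in>K t. (cmod (g k))\<^sup>2)"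
proof -
  define p where "p = eig_proj M (of_real t) (vec n (\<lambda>_. 1))"
  have p: "p = vec n (\<lambda>i. \<Sum>k\<in>K t. g k * u k i)"
    unfolding p_def by (subst eig_proj_eq) (auto simp: coef_vec g_def)
  have cp: "coef k (($) p) = (if k \<in> K t then g k else 0)" if "k < n" for k
    unfolding p coef_vec using coef_comb[OF that, of "K t"] by simp
  have "cinner p p = (\<Sum>k<n. cnj (coef k (($) p)) * coef k (($) p))"
    using parseval[of "($) p" "($) p"] by (simp add: cinner_def p)
  also have "\<dots> = (\<Sum>k\<in>K t. cnj (coef k (($) p)) * coef k (($) p))"
    by (rule sum.mono_neutral_right) (auto simp: cp)
  also have "\<dots> = (\<Sum>k\<in>K t. cnj (g k) * g k)"
    by (intro sum.cong refl) (auto simp: cp K_def)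
  finally have cinner: "cinner p p = of_real (\<Sum>k\<in>K t. (cmod (g k))\<^sup>2)"
    by (simp only: sum_cnj_mult_self)
  have "main_angle M (of_real t) = (1 / sqrt (real n)) * sqrt (\<Sum>k\<in>K t. (cmod (g k))\<^sup>2)"
    using M cinner unfolding main_angle_def p_def by (simp add: Let_def)
  then show ?thesis using assms
    by (simp add: power_mult_distrib power_divide sum_nonneg)
qed

lemma main_angle_0_iff:
  assumes "n > 0"
  shows "main_angle M (of_real t) = 0 \<longleftrightarrow> (\<forall>k\<in>K t. g k = 0)"
proof -
  have "main_angle M (of_real t) = 0 \<longleftrightarrow> real n * (main_angle M (of_real t))\<^sup>2 = 0"
    using assms by simp
  also have "\<dots> \<longleftrightarrow> (\<forall>k\<in>K t. g k = 0)"
    unfolding main_angle_sq[OF assms] by (subst sum_nonneg_eq_0_iff) auto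
  finally show ?thesis .
qed

lemma sum_eigenvalues:
  fixes h :: "real \<Rightarrow> real"
  shows "(\<Sum>i=1..length (eig_list M). h (eig_list M ! (i - 1))) = (\<Sum>t\<in>\<mu> ` {..<n}. h t)"
proof -
  have "(\<Sum>i=1..length (eig_list M). h (eig_list M ! (i - 1)))
      = (\<Sum>i<length (eig_list M). h (eig_list M ! i))"
    by (rule sum.reindex_bij_witness[of _ Suc "\<lambda>i. i - 1"]) auto
  also have "\<dots> = sum_list (map h (eig_list M))"
    by (simp add: sum_list_sum_nth atLeast0LessThan)
  also have "\<dots> = sum h (set (eig_list M))"
    by (rule sum_list_distinct_conv_sum_set) (simp add: eig_list_eq)
  also have "set (eig_list M) = \<mu> ` {..<n}" by (simp add: eig_list_eq)
  finally show ?thesis .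
qed

text \<open>The indices are grouped by eigenvalue. A term whose eigenvalue is \<theta> is a division
  by zero and hence 0, so one full sum serves for both constants of the theorem.\<close>

lemma C_eq:
  assumes "n > 0"
  shows "C \<theta> = (\<Sum>i=1..length (eig_list M).
    real n * (main_angle M (of_real (eig_list M ! (i - 1))))\<^sup>2 / (eig_list M ! (i - 1) - \<theta>))"
proof -
  have "C \<theta> = (\<Sum>t\<in>\<mu> ` {..<n}. \<Sum>k\<in>{k. k \<in> {..<n} \<and> \<mu> k = t}. (cmod (g k))\<^sup>2 / (\<mu> k - \<theta>))"
    unfolding C_def by (rule sum.image_gen) simp
  also have "\<dots> = (\<Sum>t\<in>\<mu> ` {..<n}. (\<Sum>k\<in>K t. (cmod (g k))\<^sup>2) / (t - \<theta>))"
    unfolding sum_divide_distrib by (intro sum.cong refl) (auto simp: K_def)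
  also have "\<dots> = (\<Sum>i=1..length (eig_list M).
      (\<Sum>k\<in>K (eig_list M ! (i - 1)). (cmod (g k))\<^sup>2) / (eig_list M ! (i - 1) - \<theta>))"
    by (rule sum_eigenvalues[symmetric])
  finally show ?thesis by (simp only: main_angle_sq[OF assms])
qed

section \<open>Transfer between the shifted matrix and its diagonal model\<close>

lemma coef_shifted:
  assumes "k < n"
  shows "coef k (\<lambda>i. \<Sum>j<n. (M $$ (i, j) - (if i = j then of_real \<theta> else 0) + of_real c) * x j)
    = of_real (\<mu> k - \<theta>) * coef k x + of_real c * g k * (\<Sum>l<n. cnj (g l) * coef l x)"
proof -
  have s: "(\<Sum>j<n. x j) = (\<Sum>l<n. cnj (g l) * coef l x)"
    using parseval[of "\<lambda>_. 1" x] by (simp add: g_def)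
  have "(\<Sum>j<n. (M $$ (i, j) - (if i = j then of_real \<theta> else 0) + of_real c) * x j)
      = (\<Sum>j<n. M $$ (i, j) * x j) - of_real \<theta> * x i + of_real c * (\<Sum>l<n. cnj (g l) * coef l x)"
    if "i < n" for i
  proof -
    have "(\<Sum>j<n. (if i = j then of_real \<theta> else 0) * x j) = (\<Sum>j<n. if i = j then of_real \<theta> * x i else 0)"
      by (rule sum.cong) auto
    then show ?thesis using that
      by (simp add: distrib_right left_diff_distrib sum.distrib sum_subtractf sum_distrib_left s[symmetric])
  qed
  then have "coef k (\<lambda>i. \<Sum>j<n. (M $$ (i, j) - (if i = j then of_real \<theta> else 0) + of_real c) * x j)
      = coef k (\<lambda>i. (\<Sum>j<n. M $$ (i, j) * x j) - of_real \<theta> * x i + of_real c * (\<Sum>l<n. cnj (g l) * coef l x))"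
    by (rule coef_cong)
  also have "coef k (\<lambda>i. y i - a * x i + b * s) = coef k y - a * coef k x + b * s * g k" for y a b s
    unfolding g_def coef_def
    by (simp add: distrib_left right_diff_distrib sum.distrib sum_subtractf sum_distrib_left mult_ac)
  finally show ?thesis unfolding coef_mult[OF assms] by (simp add: algebra_simps)
qed

lemma form_shifted:
  "Re (\<Sum>i<n. cnj (x i) * (\<Sum>j<n. (M $$ (i, j) - (if i = j then of_real \<theta> else 0) + of_real c) * x j))
    = (\<Sum>k<n. (\<mu> k - \<theta>) * (cmod (coef k x))\<^sup>2) + c * (cmod (\<Sum>k<n. cnj (g k) * coef k x))\<^sup>2"
proof -
  let ?s = "\<Sum>l<n. cnj (g l) * coef l x"
  have "(\<Sum>i<n. cnj (x i) * (\<Sum>j<n. (M $$ (i, j) - (if i = j then of_real \<theta> else 0) + of_real c) * x j))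
     = (\<Sum>k<n. cnj (coef k x) * (of_real (\<mu> k - \<theta>) * coef k x + of_real c * g k * ?s))"
    unfolding parseval[of x] by (intro sum.cong refl) (simp add: coef_shifted)
  also have "\<dots> = (\<Sum>k<n. of_real ((\<mu> k - \<theta>) * (cmod (coef k x))\<^sup>2))
      + of_real c * (\<Sum>k<n. cnj (cnj (g k) * coef k x)) * ?s"
    unfolding of_real_mult complex_norm_square
    by (simp add: distrib_left sum.distrib sum_distrib_left sum_distrib_right mult_ac)
  also have "\<dots> = of_real ((\<Sum>k<n. (\<mu> k - \<theta>) * (cmod (coef k x))\<^sup>2) + c * (cmod ?s)\<^sup>2)"
    unfolding of_real_add of_real_mult complex_norm_square of_real_sum cnj_sum[symmetric] by (simp add: mult_ac)
  finally show ?thesis by (simp only: Re_complex_of_real)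
qed

text \<open>The linear map \<open>y\<close> sends X to the combination of the Gram vectors with
  coefficients X. Its squared norm is b times the form, and X lies in the kernel as soon as
  \<open>y X\<close> vanishes.\<close>

lemma gram_imp_psd_rank_le:
  fixes \<psi> :: "nat \<Rightarrow> nat \<Rightarrow> complex"
  assumes b: "b > 0"
    and gram: "\<And>i j. i < n \<Longrightarrow> j < n \<Longrightarrow> (\<Sum>e<d. cnj (\<psi> i e) * \<psi> j e)
      = of_real b * (M $$ (i, j) - (if i = j then of_real \<theta> else 0) + of_real c)"
  shows "psd \<theta> c" "rank_le d \<theta> c"
proof -
  let ?N = "\<lambda>i j. M $$ (i, j) - (if i = j then of_real \<theta> else 0) + of_real c"
  define y where "y = (\<lambda>X e. \<Sum>j<n. X j * \<psi> j e)"
  have y: "(\<Sum>e<d. cnj (\<psi> i e) * y X e) = of_real b * (\<Sum>j<n. ?N i j * X j)" if "i < n" for i X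
  proof -
    have "(\<Sum>e<d. cnj (\<psi> i e) * y X e) = (\<Sum>j<n. (\<Sum>e<d. cnj (\<psi> i e) * \<psi> j e) * X j)"
      unfolding y_def sum_distrib_left sum_distrib_right by (subst sum.swap) (simp add: mult_ac)
    then show ?thesis using gram that by (simp add: sum_distrib_left mult.assoc)
  qed
  show "psd \<theta> c" unfolding psd_def
  proof
    fix x
    define X where "X = (\<lambda>i. \<Sum>l<n. x l * u l i)"
    have cX: "coef k X = x k" if "k < n" for k
      unfolding X_def using coef_comb[OF that, of "{..<n}"] that by simp
    have cy: "cnj (y X e) = (\<Sum>i<n. cnj (X i) * cnj (\<psi> i e))" for e
      by (simp add: y_def)
    have "(\<Sum>e<d. cnj (y X e) * y X e) = (\<Sum>i<n. cnj (X i) * (\<Sum>e<d. cnj (\<psi> i e) * y X e))"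
      unfolding cy sum_distrib_right sum_distrib_left
      by (subst sum.swap) (simp add: mult_ac)
    also have "\<dots> = of_real b * (\<Sum>i<n. cnj (X i) * (\<Sum>j<n. ?N i j * X j))"
      using y by (simp add: sum_distrib_left mult_ac)
    finally have *: "of_real (\<Sum>e<d. (cmod (y X e))\<^sup>2) = of_real b * (\<Sum>i<n. cnj (X i) * (\<Sum>j<n. ?N i j * X j))"
      by (simp only: sum_cnj_mult_self)
    have Re: "Re (of_real b * w) = b * Re w" for w by simp
    have eq: "(\<Sum>e<d. (cmod (y X e))\<^sup>2) = b * Re (\<Sum>i<n. cnj (X i) * (\<Sum>j<n. ?N i j * X j))"
      using arg_cong[OF *, of Re] unfolding Re Re_complex_of_real .
    have "0 \<le> (\<Sum>e<d. (cmod (y X e))\<^sup>2)" by (simp add: sum_nonneg)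
    then have "0 \<le> b * Re (\<Sum>i<n. cnj (X i) * (\<Sum>j<n. ?N i j * X j))"
      unfolding eq .
    then have "0 \<le> Re (\<Sum>i<n. cnj (X i) * (\<Sum>j<n. ?N i j * X j))"
      using b by (simp add: zero_le_mult_iff)
    then show "0 \<le> (\<Sum>k<n. (\<mu> k - \<theta>) * (cmod (x k))\<^sup>2) + c * (cmod (\<Sum>k<n. cnj (g k) * x k))\<^sup>2"
      unfolding form_shifted by (simp add: cX)
  qed
  show "rank_le d \<theta> c" unfolding rank_le_def
  proof (intro allI impI, rule ccontr)
    fix R assume R: "R \<subseteq> {..<n}"
      "\<forall>x. (\<forall>k. k \<notin> R \<longrightarrow> x k = 0) \<and> ker \<theta> c x \<longrightarrow> (\<forall>k\<in>R. x k = 0)" "\<not> card R \<le> d"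
    have fin: "finite R" using R(1) finite_subset by blast
    \<comment> \<open>Vanishing of \<open>y\<close> amounts to d equations in more than d unknowns,
      so some nonzero combination of the \<open>u k\<close> with k in R lands in the kernel.\<close>
    obtain x0 where x0: "\<exists>k\<in>R. x0 k \<noteq> 0" "\<forall>e<d. (\<Sum>k\<in>R. y (u k) e * x0 k) = 0"
      using homogeneous_system_nontrivial[OF fin, of d "\<lambda>e k. y (u k) e"] R(3) by auto
    define x where "x = (\<lambda>k. if k \<in> R then x0 k else 0)"
    define X where "X = (\<lambda>i. \<Sum>l\<in>R. x0 l * u l i)"
    have cX: "coef k X = x k" if "k < n" for k
      unfolding X_def x_def using coef_comb[OF that R(1)] by simp
    have yX: "y X e = 0" if "e < d" for e
    proof -
      have "y X e = (\<Sum>k\<in>R. y (u k) e * x0 k)"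
        unfolding y_def X_def sum_distrib_right by (subst sum.swap) (simp add: mult_ac)
      then show ?thesis using x0(2) that by simp
    qed
    have "(\<Sum>j<n. ?N i j * X j) = 0" if "i < n" for i
      using y[OF that, of X] yX b by simp
    then have "coef k (\<lambda>i. \<Sum>j<n. ?N i j * X j) = 0" for k by (simp add: coef_def)
    then have "ker \<theta> c x" unfolding ker_def using coef_shifted[of _ \<theta> c X] by (simp add: cX)
    moreover have "\<forall>k. k \<notin> R \<longrightarrow> x k = 0" by (simp add: x_def)
    ultimately have "\<forall>k\<in>R. x k = 0" using R(2) by blast
    with x0(1) show False by (auto simp: x_def)
  qed
qed

text \<open>Kernel vectors are supplied in eigenbasis coordinates; synthesizing them from the
  \<open>u l\<close> preserves both the kernel equations and independence. The Gram vectors are not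
  normalized yet.\<close>

lemma psd_imp_gram:
  fixes Q :: "nat set"
  assumes psd: "psd \<theta> c" and Q: "finite Q" and ker: "\<And>q. q \<in> Q \<Longrightarrow> ker \<theta> c (z q)"
    and indep: "\<And>y. (\<And>i. i < n \<Longrightarrow> (\<Sum>q\<in>Q. y q * z q i) = 0) \<Longrightarrow> \<forall>q\<in>Q. y q = 0"
  shows "\<exists>d \<psi>. d \<le> n - card Q \<and> (\<forall>i<n. \<forall>j<n. (\<Sum>e<d. cnj (\<psi> i e) * \<psi> j e)
      = M $$ (i, j) - (if i = j then of_real \<theta> else 0) + of_real c)"
proof (rule psd_gram[where z = "\<lambda>q i. \<Sum>l<n. z q l * u l i", OF _ _ Q])
  let ?N = "\<lambda>i j. M $$ (i, j) - (if i = j then of_real \<theta> else 0) + of_real c"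
  show "?N i j = cnj (?N j i)" if "i < n" "j < n" for i j
    by (simp add: herm[OF that, symmetric])
  show "0 \<le> Re (\<Sum>i<n. cnj (x i) * (\<Sum>j<n. ?N i j * x j))" for x
    unfolding form_shifted by (rule psdD[OF psd])
  show "(\<Sum>j<n. ?N i j * (\<Sum>l<n. z q l * u l j)) = 0" if q: "q \<in> Q" and i: "i < n" for q i
  proof (rule coef_eqI[OF _ i, where y = "\<lambda>_. 0"])
    fix k assume k: "k < n"
    have "coef k (\<lambda>i. \<Sum>j<n. ?N i j * (\<Sum>l<n. z q l * u l j)) = 0"
      unfolding coef_shifted[OF k] using ker[OF q] k
      by (simp add: coef_comb ker_def)
    then show "coef k (\<lambda>i. \<Sum>j<n. ?N i j * (\<Sum>l<n. z q l * u l j)) = coef k (\<lambda>_. 0)"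
      by (simp add: coef_def)
  qed
  show "\<forall>q\<in>Q. y q = 0" if 0: "\<And>i. i < n \<Longrightarrow> (\<Sum>q\<in>Q. y q * (\<Sum>l<n. z q l * u l i)) = 0" for y
  proof (rule indep)
    fix k assume k: "k < n"
    have "(\<Sum>q\<in>Q. y q * z q k) = coef k (\<lambda>i. \<Sum>l<n. (\<Sum>q\<in>Q. y q * z q l) * u l i)"
      using k by (simp add: coef_comb)
    also have "\<dots> = coef k (\<lambda>i. \<Sum>q\<in>Q. y q * (\<Sum>l<n. z q l * u l i))"
      unfolding sum_distrib_left sum_distrib_right by (subst sum.swap) (simp add: mult.assoc)
    also have "\<dots> = 0" using 0 by (simp add: coef_def)
    finally show "(\<Sum>q\<in>Q. y q * z q k) = 0" .
  qed
qed

lemma ex_main: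
  assumes "n > 0"
  shows "\<exists>k<n. g k \<noteq> 0"
proof (rule ccontr)
  assume "\<not> ?thesis"
  then have "(1::complex) = 0"
    using coef_eqI[of "\<lambda>_. 1" "\<lambda>_. 0" 0] assms by (auto simp: g_def coef_def)
  then show False by simp
qed

end

section \<open>Representations of tournaments\<close>

locale tournament_eigenbasis = hermitian_eigenbasis "card V" "seidel_mat V E" u \<mu>
  for V :: "'a set" and E u \<mu> +
  assumes tour: "tournament V E" and card2: "card V \<ge> 2"
begin

abbreviation n :: nat where "n \<equiv> card V"
abbreviation f :: "nat \<Rightarrow> 'a" where "f \<equiv> vert_enum V"

lemma f: "bij_betw f {..<n} V"
proof -
  have "\<exists>h. bij_betw h {0..<card V} V"
    using tour by (intro ex_bij_betw_nat_finite) (simp add: tournament_def)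
  then show ?thesis unfolding vert_enum_def atLeast0LessThan[symmetric] by (rule someI_ex)
qed

lemma f_mem: "i < n \<Longrightarrow> f i \<in> V"
  using f by (auto simp: bij_betw_def)

lemma f_eq_iff: "i < n \<Longrightarrow> j < n \<Longrightarrow> f i = f j \<longleftrightarrow> i = j"
  using f by (auto simp: bij_betw_def inj_on_def)

lemma edge_cases:
  assumes "x \<in> V" "y \<in> V" "x \<noteq> y"
  obtains "(x, y) \<in> E" "(y, x) \<notin> E" | "(y, x) \<in> E" "(x, y) \<notin> E"
proof -
  have "(x, y) \<in> E \<union> E\<inverse> \<union> {(x, x) | x. x \<in> V}" "E \<inter> E\<inverse> = {}"
    using tour assms unfolding tournament_def by auto
  then show ?thesis using that assms(3) by blast
qed

lemma no_loop: "(x, x) \<notin> E"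
  using tour unfolding tournament_def by blast

lemma seidel_index:
  assumes "i < n" "j < n"
  shows "seidel_mat V E $$ (i, j)
    = (if i = j then 0 else if (f i, f j) \<in> E then \<i> else - \<i>)"
proof (cases "i = j")
  case True
  then show ?thesis using assms by (simp add: seidel_mat_def adj_mat_def no_loop)
next
  case False
  then show ?thesis using assms
    by (cases rule: edge_cases[OF f_mem[OF assms(1)] f_mem[OF assms(2)]])
      (auto simp: seidel_mat_def adj_mat_def f_eq_iff)
qed

section \<open>From representations to Gram matrices and back\<close>

lemma representationD:
  assumes rep: "is_representation V E d \<phi> \<alpha>"
  shows "\<exists>\<theta> c. psd \<theta> c \<and> rank_le d \<theta> c \<and> \<alpha> = (of_real c + \<i>) / of_real (c - \<theta>)"
proof -
  define a b where "a = Re \<alpha>" and "b = Im \<alpha>"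
  define \<theta> c where "\<theta> = (a - 1) / b" and "c = a / b"
  have b: "b > 0" using rep by (simp add: is_representation_def b_def)
  have \<alpha>: "\<alpha> = of_real a + \<i> * of_real b" by (simp add: complex_eq_iff a_def b_def)
  have \<phi>: "\<phi> x \<in> carrier_vec d" "cinner (\<phi> x) (\<phi> x) = 1" if "x \<in> V" for x
    using rep that by (auto simp: is_representation_def Omega_def)
  have gram: "(\<Sum>e<d. cnj (\<phi> (f i) $ e) * \<phi> (f j) $ e)
      = of_real b * (seidel_mat V E $$ (i, j) - (if i = j then of_real \<theta> else 0) + of_real c)"
    if ij: "i < n" "j < n" for i j
  proof -
    have "(\<Sum>e<d. cnj (\<phi> (f i) $ e) * \<phi> (f j) $ e) = cinner (\<phi> (f i)) (\<phi> (f j))"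
      using \<phi>(1)[OF f_mem[OF ij(1)]] by (simp add: cinner_def)
    also have "\<dots> = of_real b * seidel_mat V E $$ (i, j) + (if i = j then 1 else of_real a)"
    proof (cases "i = j")
      case True
      then show ?thesis using \<phi>(2)[OF f_mem[OF ij(1)]] ij by (simp add: seidel_index)
    next
      case False
      then have ne: "f i \<noteq> f j" using f_eq_iff ij by blast
      have F: "(f i, f j) \<in> E \<longrightarrow> cinner (\<phi> (f i)) (\<phi> (f j)) = \<alpha>"
        "(f j, f i) \<in> E \<longrightarrow> cinner (\<phi> (f i)) (\<phi> (f j)) = cnj \<alpha>"
        using rep ne f_mem ij by (auto simp: is_representation_def)
      show ?thesis
        by (cases rule: edge_cases[OF f_mem[OF ij(1)] f_mem[OF ij(2)] ne])
          (use F False ij in \<open>auto simp: seidel_index \<alpha>\<close>)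
    qed
    also have "\<dots> = of_real b * (seidel_mat V E $$ (i, j) - (if i = j then of_real \<theta> else 0) + of_real c)"
    proof -
      have "of_real b * of_real c = (of_real a :: complex)"
        "of_real b * of_real \<theta> = (of_real (a - 1) :: complex)"
        using b unfolding of_real_mult[symmetric] c_def \<theta>_def by simp_all
      then show ?thesis by (simp add: algebra_simps)
    qed
    finally show ?thesis .
  qed
  have "c - \<theta> = 1 / b" by (simp add: c_def \<theta>_def diff_divide_distrib)
  moreover have "(of_real c + \<i>) / of_real (1 / b) = \<alpha>"
    using b by (simp add: \<alpha> c_def algebra_simps)
  ultimately have "\<alpha> = (of_real c + \<i>) / of_real (c - \<theta>)" by simp
  then show ?thesis using gram_imp_psd_rank_le[OF b gram] by blast
qed

text \<open>All Gram vectors have squared norm \<open>b = c - \<theta>\<close>, so dividing by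
  \<open>sqrt b\<close> puts them on the unit sphere.\<close>

lemma gram_imp_representable:
  assumes gram: "\<forall>i<n. \<forall>j<n. (\<Sum>e<d. cnj (\<psi> i e) * \<psi> j e)
      = seidel_mat V E $$ (i, j) - (if i = j then of_real \<theta> else 0) + of_real c"
  shows "representable V E d"
proof -
  define b where "b = c - \<theta>"
  have norm: "(\<Sum>e<d. (cmod (\<psi> i e))\<^sup>2) = b" if "i < n" for i
  proof -
    have "complex_of_real (\<Sum>e<d. (cmod (\<psi> i e))\<^sup>2) = of_real b"
      unfolding sum_cnj_mult_self[symmetric] using gram that by (simp add: b_def seidel_index)
    then show ?thesis by (simp only: of_real_eq_iff)
  qed
  \<comment> \<open>Otherwise vector 0 is zero and so is its inner product with vector 1, although
    that entry has imaginary part 1 or -1. Two vertices are needed here.\<close>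
  have "b > 0"
  proof (rule ccontr)
    assume "\<not> b > 0"
    then have "(\<Sum>e<d. (cmod (\<psi> 0 e))\<^sup>2) \<le> 0" using norm[of 0] card2 by simp
    then have "(\<Sum>e<d. (cmod (\<psi> 0 e))\<^sup>2) = 0" by (simp add: sum_nonneg order_antisym)
    then have "\<psi> 0 e = 0" if "e < d" for e
      using that by (subst (asm) sum_nonneg_eq_0_iff) auto
    then have "seidel_mat V E $$ (0, 1) + of_real c = 0"
      using gram[rule_format, of 0 1] card2 by simp
    then show False using card2
      by (auto simp: seidel_index complex_eq_iff split: if_splits)
  qed
  define \<phi> where "\<phi> x = vec d (\<lambda>e. \<psi> (the_inv_into {..<n} f x) e / of_real (sqrt b))" for x
  define \<alpha> where "\<alpha> = (of_real c + \<i>) / of_real b"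
  have inv: "the_inv_into {..<n} f (f i) = i" if "i < n" for i
    using f that by (intro the_inv_into_f_f) (auto simp: bij_betw_def)
  have sq: "complex_of_real (sqrt b) * of_real (sqrt b) = of_real b"
    unfolding of_real_mult[symmetric] using \<open>b > 0\<close> by simp
  have ci: "cinner (\<phi> (f i)) (\<phi> (f j))
      = (seidel_mat V E $$ (i, j) - (if i = j then of_real \<theta> else 0) + of_real c) / of_real b"
    if "i < n" "j < n" for i j
  proof -
    have "cinner (\<phi> (f i)) (\<phi> (f j))
        = (\<Sum>e<d. cnj (\<psi> i e) * \<psi> j e / (of_real (sqrt b) * of_real (sqrt b)))"
      using that by (simp add: cinner_def \<phi>_def inv)
    then show ?thesis unfolding sq sum_divide_distrib[symmetric] using gram that by simp
  qed
  have "is_representation V E d \<phi> \<alpha>"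
    unfolding is_representation_def
  proof (intro conjI ballI impI)
    show "Im \<alpha> > 0" using \<open>b > 0\<close> by (simp add: \<alpha>_def)
  next
    fix x assume "x \<in> V"
    then obtain i where i: "i < n" "x = f i" using f by (auto simp: bij_betw_def)
    then have "cinner (\<phi> x) (\<phi> x) = 1" using \<open>b > 0\<close>
      by (simp add: ci seidel_index b_def[symmetric] of_real_diff[symmetric] del: of_real_diff)
    then show "\<phi> x \<in> Omega d" by (simp add: Omega_def \<phi>_def)
  next
    fix x y assume "x \<in> V" "y \<in> V" "x \<noteq> y"
    moreover have "V = f ` {..<n}" using f by (simp add: bij_betw_def)
    ultimately obtain i j where ij: "i < n" "x = f i" "j < n" "y = f j" "i \<noteq> j"
      by blast
    { assume "(x, y) \<in> E"
      then show "cinner (\<phi> x) (\<phi> y) = \<alpha>"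
        using ij by (simp add: ci seidel_index \<alpha>_def add.commute) }
    { assume "(y, x) \<in> E"
      then have "(x, y) \<notin> E" using tour by (auto simp: tournament_def)
      then show "cinner (\<phi> x) (\<phi> y) = cnj \<alpha>"
        using ij by (simp add: ci seidel_index \<alpha>_def) }
  qed
  then show ?thesis by (auto simp: representable_def)
qed

lemma n_pos: "n > 0"
  using card2 by simp

text \<open>The coordinate vectors of \<open>K \<theta>\<close> and the vector of
  \<open>ker_C\<close> form an independent kernel family of size
  \<open>card (K \<theta>) + 1\<close>.\<close>

lemma representable_critical:
  assumes psd: "psd \<theta> (- 1 / C \<theta>)" and g0: "\<And>k. k \<in> K \<theta> \<Longrightarrow> g k = 0" and C: "C \<theta> \<noteq> 0"
  shows "\<exists>d \<le> n - card (K \<theta>) - 1. representable V E d"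
proof -
  have "\<exists>k0<n. (cmod (g k0))\<^sup>2 / (\<mu> k0 - \<theta>) \<noteq> 0"
  proof (rule ccontr)
    assume "\<not> ?thesis"
    then have "C \<theta> = 0" unfolding C_def by (intro sum.neutral) auto
    with C show False ..
  qed
  then obtain k0 where k0: "k0 < n" "g k0 \<noteq> 0" "k0 \<notin> K \<theta>" by (auto simp: K_def)
  \<comment> \<open>The index \<open>k0\<close>, which lies outside \<open>K \<theta>\<close>,
    labels the extra kernel vector. That vector is nonzero at \<open>k0\<close>, where all the
    others vanish, so its coefficient can be read off first.\<close>
  define z where "z = (\<lambda>q. if q = k0 then (\<lambda>k. g k / of_real (\<mu> k - \<theta>))
    else (\<lambda>i. if i = q then 1 else 0))"
  have "\<exists>d \<psi>. d \<le> n - card (insert k0 (K \<theta>)) \<and> (\<forall>i<n. \<forall>j<n. (\<Sum>e<d. cnj (\<psi> i e) * \<psi> j e)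
      = seidel_mat V E $$ (i, j) - (if i = j then of_real \<theta> else 0) + of_real (- 1 / C \<theta>))"
  proof (rule psd_imp_gram[OF psd, where z = z])
    show "ker \<theta> (- 1 / C \<theta>) (z q)" if "q \<in> insert k0 (K \<theta>)" for q
    proof (cases "q = k0")
      case True
      then show ?thesis using ker_C[OF g0 C] by (simp add: z_def)
    next
      case False
      then show ?thesis using ker_K[of q \<theta>] g0 that by (simp add: z_def)
    qed
  next
    fix y assume 0: "\<And>i. i < n \<Longrightarrow> (\<Sum>q\<in>insert k0 (K \<theta>). y q * z q i) = 0"
    have sum: "(\<Sum>q\<in>insert k0 (K \<theta>). y q * z q i) = y k0 * z k0 i + (if i \<in> K \<theta> then y i else 0)" for i
    proof -
      have "(\<Sum>q\<in>K \<theta>. y q * z q i) = (\<Sum>q\<in>K \<theta>. if i = q then y i else 0)"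
        by (rule sum.cong) (use k0 in \<open>auto simp: z_def\<close>)
      then show ?thesis using k0 by simp
    qed
    have "z k0 k0 \<noteq> 0" using k0 by (simp add: z_def K_def of_real_diff[symmetric] del: of_real_diff)
    then have yk0: "y k0 = 0" using 0[of k0] k0 unfolding sum by simp
    then have "y q = 0" if "q \<in> K \<theta>" for q
      using 0[of q] that unfolding sum by (simp add: K_def)
    with yk0 show "\<forall>q\<in>insert k0 (K \<theta>). y q = 0" by blast
  qed simp
  then obtain d \<psi> where d: "d \<le> n - card (insert k0 (K \<theta>))"
    and gram: "\<forall>i<n. \<forall>j<n. (\<Sum>e<d. cnj (\<psi> i e) * \<psi> j e)
      = seidel_mat V E $$ (i, j) - (if i = j then of_real \<theta> else 0) + of_real (- 1 / C \<theta>)"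
    by blast
  from d have "d \<le> n - card (K \<theta>) - 1" using k0(3) by simp
  then show ?thesis using gram_imp_representable[OF gram] by blast
qed

lemma representable_psd_0:
  assumes "\<And>k. k < n \<Longrightarrow> \<theta> \<le> \<mu> k"
  shows "\<exists>d \<le> n - card (K \<theta>). representable V E d"
proof -
  have "\<exists>d \<psi>. d \<le> n - card (K \<theta>) \<and> (\<forall>i<n. \<forall>j<n. (\<Sum>e<d. cnj (\<psi> i e) * \<psi> j e)
      = seidel_mat V E $$ (i, j) - (if i = j then of_real \<theta> else 0) + of_real 0)"
  proof (rule psd_imp_gram[OF psd_0[OF assms], where z = "\<lambda>q i. if i = q then 1 else 0"])
    show "ker \<theta> 0 (\<lambda>i. if i = q then 1 else 0)" if "q \<in> K \<theta>" for q
      using ker_K[OF that] by simp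
  next
    fix y :: "nat \<Rightarrow> complex"
    assume 0: "\<And>i. i < n \<Longrightarrow> (\<Sum>q\<in>K \<theta>. y q * (if i = q then 1 else 0)) = 0"
    have sum: "(\<Sum>q\<in>K \<theta>. y q * (if i = q then 1 else 0)) = (if i \<in> K \<theta> then y i else 0)" for i
      by (simp add: if_distrib cong: if_cong)
    show "\<forall>q\<in>K \<theta>. y q = 0"
    proof
      fix q assume q: "q \<in> K \<theta>"
      then show "y q = 0" using 0[of q] unfolding sum by (simp add: K_def)
    qed
  qed simp_all
  then show ?thesis using gram_imp_representable by blast
qed

lemma C_pos:
  assumes "\<And>k. k < n \<Longrightarrow> \<theta> \<le> \<mu> k" "\<And>k. k \<in> K \<theta> \<Longrightarrow> g k = 0"
  shows "C \<theta> > 0"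
proof -
  obtain k0 where k0: "k0 < n" "g k0 \<noteq> 0" using ex_main[OF n_pos] by blast
  have "\<mu> k0 \<noteq> \<theta>" using k0 assms(2)[of k0] by (auto simp: K_def)
  then have "\<theta> < \<mu> k0" using assms(1)[OF k0(1)] by simp
  then show ?thesis unfolding C_def
    by (intro sum_pos2[where i = k0]) (use k0 assms(1) in \<open>auto intro!: divide_nonneg_nonneg\<close>)
qed

lemma rank_ge_nonspectral:
  assumes "rank_le d \<theta> c" "K \<theta> = {}"
  shows "n - 1 \<le> d"
proof -
  obtain k0 where k0: "k0 < n" "g k0 \<noteq> 0" using ex_main[OF n_pos] by blast
  show ?thesis using rank_ge_generic[OF assms(1) k0(1) _ k0(2)] assms(2) by simp
qed

lemma card_K_less:
  assumes "\<And>k. k \<in> K \<theta> \<Longrightarrow> g k = 0"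
  shows "card (K \<theta>) < n"
proof -
  obtain k0 where k0: "k0 < n" "g k0 \<noteq> 0" using ex_main[OF n_pos] by blast
  then have "K \<theta> \<subset> {..<n}" using assms by (auto simp: K_def)
  then have "card (K \<theta>) < card {..<n}" by (intro psubset_card_mono) auto
  then show ?thesis by simp
qed

text \<open>The second claim settles the uniqueness of the angle: attaining the bound determines
  \<open>c\<close>, and \<open>\<theta>\<close> and \<open>c\<close> together determine
  \<open>\<alpha>\<close>.\<close>

lemma rank_ge_critical:
  assumes "rank_le d \<theta> c" "\<And>k. k \<in> K \<theta> \<Longrightarrow> g k = 0"
  shows "n - card (K \<theta>) - 1 \<le> d"
    "d \<le> n - card (K \<theta>) - 1 \<Longrightarrow> c = - 1 / C \<theta> \<and> C \<theta> \<noteq> 0"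
proof -
  obtain k0 where k0: "k0 < n" "g k0 \<noteq> 0" using ex_main[OF n_pos] by blast
  then have "k0 \<notin> K \<theta>" using assms(2) by blast
  then show "n - card (K \<theta>) - 1 \<le> d" using rank_ge_generic[OF assms(1) k0(1) _ k0(2)] by simp
  assume "d \<le> n - card (K \<theta>) - 1"
  \<comment> \<open>The strict bound on \<open>card (K \<theta>)\<close> keeps the truncated
    subtraction of 1 effective.\<close>
  then have "\<not> n - card (K \<theta>) \<le> d" using card_K_less[of \<theta>, OF assms(2)] by linarith
  then have "c * C \<theta> = - 1" using rank_ge_off_critical[OF assms] by blast
  then show "c = - 1 / C \<theta> \<and> C \<theta> \<noteq> 0" by (cases "C \<theta> = 0") (auto simp: field_simps)
qed

lemma critical_angle:
  assumes "\<alpha> = (of_real c + \<i>) / of_real (c - \<theta>)" "c = - 1 / C0" "C0 \<noteq> 0"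
  shows "\<alpha> = (1 - of_real C0 * \<i>) / (1 + of_real (C0 * \<theta>))"
proof -
  have "\<alpha> = (- of_real C0 * (of_real c + \<i>)) / (- of_real C0 * of_real (c - \<theta>))"
    using assms(1,3) by simp
  also have "- of_real C0 * (of_real c + \<i>) = 1 - of_real C0 * \<i>"
    using assms by (simp add: algebra_simps)
  also have "- of_real C0 * of_real (c - \<theta>) = (1 + of_real (C0 * \<theta>) :: complex)"
    using assms by (simp add: algebra_simps)
  finally show ?thesis .
qed

section \<open>Position of \<theta> relative to the two smallest eigenvalues\<close>

context
  fixes t1 t2 :: real
  assumes t1: "t1 \<in> \<mu> ` {..<n}" and t2: "t2 \<in> \<mu> ` {..<n}" and t12: "t1 < t2"
    and gap_all: "\<forall>k<n. \<mu> k = t1 \<or> t2 \<le> \<mu> k"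
begin

lemmas gap = gap_all[rule_format]

lemma t1_le: "k < n \<Longrightarrow> t1 \<le> \<mu> k"
  using gap[of k] t12 by auto

lemma K_pos: "card (K t1) > 0" "card (K t2) > 0"
  using t1 t2 by (auto simp: card_gt_0_iff K_def)

lemma psd_cases:
  assumes psd: "psd \<theta> c"
  obtains "K \<theta> = {}" "\<theta> < t1 \<or> (\<theta> < t2 \<and> card (K t1) = 1)" | "\<theta> = t1"
  | "\<theta> = t2" "card (K t1) = 1" "\<forall>k\<in>K t2. g k = 0" "C t2 < 0" "\<exists>k\<in>K t1. g k \<noteq> 0"
proof -
  obtain k1 k2 where k: "k1 < n" "\<mu> k1 = t1" "k2 < n" "\<mu> k2 = t2" using t1 t2 by auto
  show ?thesis
  proof (cases "\<theta> \<le> t1")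
    case True
    show ?thesis
    proof (cases "\<theta> = t1")
      case False
      then have lt: "\<theta> < t1" using True by simp
      have "\<mu> l \<noteq> \<theta>" if "l < n" for l using t1_le[OF that] lt by simp
      then have "K \<theta> = {}" by (auto simp: K_def)
      then show ?thesis using that(1) lt by blast
    qed (rule that(2))
  next
    case False
    then have lt: "\<mu> k1 < \<theta>" using k by simp
    \<comment> \<open>Only \<open>k1\<close> may lie below \<theta>. This makes \<open>t1\<close>
      simple, excludes \<theta> above \<open>t2\<close>, and kills g on \<open>K t2\<close> when
      \<theta> equals \<open>t2\<close>.\<close>
    have uniq: "\<mu> l = \<theta> \<and> g l = 0" if "l < n" "l \<noteq> k1" "\<mu> l \<le> \<theta>" for l
      using psd_below_unique[OF psd k(1) that(1) that(2)[symmetric] lt that(3)] by simp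
    have "K t1 = {k1}"
    proof -
      have "l = k1" if "l \<in> K t1" for l
      proof (rule ccontr)
        assume "l \<noteq> k1"
        moreover have "l < n" "\<mu> l < \<theta>" using that lt k(2) by (auto simp: K_def)
        ultimately show False using uniq[of l] by simp
      qed
      moreover have "k1 \<in> K t1" using k(1,2) by (simp add: K_def)
      ultimately show ?thesis by blast
    qed
    then have c1: "card (K t1) = 1" by simp
    have "k2 \<noteq> k1"
    proof
      assume "k2 = k1"
      with k(2,4) t12 show False by simp
    qed
    then have "\<theta> \<le> t2" using uniq[of k2] k(3,4) by linarith
    show ?thesis
    proof (cases "\<theta> = t2")
      case True
      have "\<forall>k\<in>K t2. g k = 0"
      proof
        fix l assume "l \<in> K t2"
        then have "l < n" "\<mu> l = \<theta>" using True by (auto simp: K_def)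
        moreover have "l \<noteq> k1" using \<open>\<mu> l = \<theta>\<close> lt by auto
        ultimately show "g l = 0" using uniq[of l] by simp
      qed
      moreover have "C t2 < 0" using C_neg[OF psd k(1) lt] True by simp
      moreover have "\<exists>k\<in>K t1. g k \<noteq> 0"
        using psd_below(1)[OF psd k(1) lt] k(1,2) unfolding K_def by blast
      ultimately show ?thesis using that(3) True c1 by blast
    next
      case neq: False
      then have "\<theta> < t2" using \<open>\<theta> \<le> t2\<close> by simp
      moreover have "K \<theta> = {}" 
      proof -
        have "\<mu> l \<noteq> \<theta>" if "l < n" for l using gap[OF that] \<open>\<theta> < t2\<close> False by auto
        then show ?thesis by (auto simp: K_def)
      qed
      ultimately show ?thesis using that(1) c1 by blast
    qed
  qed
qed

end

lemma Rep_eqI: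
  assumes "\<exists>d\<le>r. representable V E d" "\<And>d \<phi> \<alpha>. is_representation V E d \<phi> \<alpha> \<Longrightarrow> r \<le> d"
  shows "representable V E (Rep V E)" "Rep V E = r"
proof -
  obtain d where d: "d \<le> r" "representable V E d" using assms(1) by blast
  show rep: "representable V E (Rep V E)" unfolding Rep_def by (rule LeastI[of _ d]) (rule d(2))
  have "r \<le> Rep V E" using assms(2) rep by (auto simp: representable_def)
  moreover have "Rep V E \<le> d" unfolding Rep_def by (rule Least_le) (rule d(2))
  ultimately show "Rep V E = r" using d(1) by simp
qed

end

lemma seidel_mat_carrier: "seidel_mat V E \<in> carrier_mat (card V) (card V)"
  by (intro carrier_matI) (simp_all add: seidel_mat_def adj_mat_def)

lemma seidel_mat_hermitian:
  assumes "i < card V" "j < card V"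
  shows "seidel_mat V E $$ (i, j) = cnj (seidel_mat V E $$ (j, i))"
  using assms by (simp add: seidel_mat_def adj_mat_def)

lemma tournament_eigenbasis_exists:
  assumes "tournament V E" "card V \<ge> 2"
  obtains u \<mu> where "tournament_eigenbasis V E u \<mu>"
proof -
  obtain u \<mu> where "eigenbasis (card V) (card V) (\<lambda>i j. seidel_mat V E $$ (i, j)) u \<mu>"
    using eigenbasis_exists[of "card V" "\<lambda>i j. seidel_mat V E $$ (i, j)", OF seidel_mat_hermitian]
    by blast
  then have "tournament_eigenbasis V E u \<mu>"
    using seidel_mat_carrier assms
    by (simp add: tournament_eigenbasis_def tournament_eigenbasis_axioms_def hermitian_eigenbasis_def)
  then show ?thesis by (rule that)
qed

text \<open>Each case asserts \<open>representable V E (Rep V E)\<close>, so that \<open>Rep\<close>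
  is an attained minimum and not an unspecified \<open>LEAST\<close>; the formula for the angle is
  claimed for every representation in that dimension.\<close>

theorem theorem3p1:
  fixes V :: "'a set" and E :: "('a \<times> 'a) set"
  assumes tour: "tournament V E"
    and n2: "card V \<ge> 2"
  defines "n \<equiv> card V"
    and "S \<equiv> seidel_mat V E"
    and "s \<equiv> length (eig_list (seidel_mat V E))"
    and "\<tau> \<equiv> \<lambda>i. eig_list (seidel_mat V E) ! (i - 1)"
    and "\<beta> \<equiv> \<lambda>i. main_angle (seidel_mat V E) (complex_of_real (eig_list (seidel_mat V E) ! (i - 1)))"
    and "m \<equiv> \<lambda>i. eig_mult (seidel_mat V E) (complex_of_real (eig_list (seidel_mat V E) ! (i - 1)))"
  shows
    "(\<beta> 1 = 0 \<longrightarrow>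
       (let c1 = (\<Sum>i=2..s. real n * (\<beta> i)\<^sup>2 / (\<tau> i - \<tau> 1)) in
        representable V E (Rep V E) \<and> Rep V E = n - m 1 - 1 \<and>
        (\<forall>\<phi> \<alpha>. is_representation V E (Rep V E) \<phi> \<alpha> \<longrightarrow>
           \<alpha> = (1 - complex_of_real c1 * \<i>) / (1 + complex_of_real (c1 * \<tau> 1)))))
   \<and> (\<beta> 1 \<noteq> 0 \<and> m 1 > 1 \<longrightarrow>
       representable V E (Rep V E) \<and> Rep V E = n - m 1 \<and>
       (\<forall>\<phi> \<alpha>. is_representation V E (Rep V E) \<phi> \<alpha> \<longrightarrow>
           \<alpha> = - \<i> / complex_of_real (\<tau> 1)))
   \<and> (let c2 = real n * (\<beta> 1)\<^sup>2 / (\<tau> 1 - \<tau> 2) + (\<Sum>i=3..s. real n * (\<beta> i)\<^sup>2 / (\<tau> i - \<tau> 2)) in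
       (m 1 = 1 \<and> \<beta> 2 = 0 \<and> c2 < 0 \<longrightarrow>
         representable V E (Rep V E) \<and> Rep V E = n - m 2 - 1 \<and>
         (\<forall>\<phi> \<alpha>. is_representation V E (Rep V E) \<phi> \<alpha> \<longrightarrow>
           \<alpha> = (1 - complex_of_real c2 * \<i>) / (1 + complex_of_real (c2 * \<tau> 2))))
     \<and> (\<not> (\<beta> 1 = 0) \<and> \<not> (\<beta> 1 \<noteq> 0 \<and> m 1 > 1) \<and> \<not> (m 1 = 1 \<and> \<beta> 2 = 0 \<and> c2 < 0) \<longrightarrow>
         representable V E (Rep V E) \<and> Rep V E = n - 1))"
proof -
  obtain u \<mu> where "tournament_eigenbasis V E u \<mu>"
    using tournament_eigenbasis_exists[OF tour n2] .
  then interpret tournament_eigenbasis V E u \<mu> .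
  have npos: "card V > 0" using n2 by simp
  define L where "L = eig_list (seidel_mat V E)"
  have L: "L = sorted_list_of_set (\<mu> ` {..<card V})" by (simp add: L_def eig_list_eq)
  have setL: "set L = \<mu> ` {..<card V}" by (simp add: L)
  have sorted: "sorted_wrt (<) L" by (simp add: L strict_sorted_list_of_set)
  have lenL: "length L = card (\<mu> ` {..<card V})"
    unfolding L by (rule length_sorted_list_of_set)
  \<comment> \<open>With a single eigenvalue the Seidel matrix would be scalar, but its entry at (0,
    1) is \<i> or - \<i>.\<close>
  have "length L \<ge> 2"
  proof (rule ccontr)
    assume "\<not> length L \<ge> 2"
    then have "card (\<mu> ` {..<card V}) \<le> Suc 0" unfolding lenL by linarith
    then have "\<forall>x\<in>\<mu> ` {..<card V}. \<forall>y\<in>\<mu> ` {..<card V}. x = y"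
      using card_le_Suc0_iff_eq[of "\<mu> ` {..<card V}"] by blast
    then have all: "\<mu> k = \<mu> 0" if "k < card V" for k
      using that npos by blast
    have "seidel_mat V E $$ (0, 1) = (\<Sum>k<card V. of_real (\<mu> k) * u k 0 * cnj (u k 1))"
      using n2 by (intro spectral) auto
    also have "\<dots> = (\<Sum>k<card V. of_real (\<mu> 0) * (u k 0 * cnj (u k 1)))"
    proof (rule sum.cong[OF refl])
      fix k assume "k \<in> {..<card V}"
      then have "\<mu> k = \<mu> 0" by (intro all) simp
      then show "of_real (\<mu> k) * u k 0 * cnj (u k 1) = of_real (\<mu> 0) * (u k 0 * cnj (u k 1))"
        by (simp only: mult.assoc)
    qed
    also have "\<dots> = of_real (\<mu> 0) * (\<Sum>k<card V. u k 0 * cnj (u k 1))"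
      by (rule sum_distrib_left[symmetric])
    also have "\<dots> = 0" using orthonormal_complete[OF ou, of 0 1] n2 by simp
    finally show False using n2 by (simp add: seidel_index split: if_splits)
  qed
  define t1 t2 where "t1 = L ! 0" and "t2 = L ! 1"
  have t: "t1 \<in> \<mu> ` {..<card V}" "t2 \<in> \<mu> ` {..<card V}" "t1 < t2"
  proof -
    have len: "0 < length L" "1 < length L" using \<open>length L \<ge> 2\<close> by auto
    show "t1 \<in> \<mu> ` {..<card V}" "t2 \<in> \<mu> ` {..<card V}"
      unfolding t1_def t2_def setL[symmetric] using nth_mem[OF len(1)] nth_mem[OF len(2)] .
    show "t1 < t2"
      unfolding t1_def t2_def using len(2) by (intro sorted_wrt_nth_less[OF sorted]) auto
  qed
  have gap: "\<forall>k<card V. \<mu> k = t1 \<or> t2 \<le> \<mu> k"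
  proof (intro allI impI)
    fix k assume "k < card V"
    then have "\<mu> k \<in> set L" unfolding setL by blast
    then obtain i where i: "i < length L" "L ! i = \<mu> k" by (auto simp: in_set_conv_nth)
    consider "i = 0" | "i = 1" | "i > 1" by linarith
    then show "\<mu> k = t1 \<or> t2 \<le> \<mu> k"
      using i sorted_wrt_nth_less[OF sorted, of 1 i] by cases (auto simp: t1_def t2_def)
  qed
  note t1_le = t1_le[OF t gap] and K_pos = K_pos[OF t gap] and psd_cases =
    psd_cases[OF t gap, consumes 1, case_names nonspectral first second]
  have \<tau>: "\<tau> 1 = t1" "\<tau> 2 = t2" by (simp_all add: \<tau>_def t1_def t2_def L_def)
  have \<beta>: "\<beta> 1 = 0 \<longleftrightarrow> (\<forall>k\<in>K t1. g k = 0)" "\<beta> 2 = 0 \<longleftrightarrow> (\<forall>k\<in>K t2. g k = 0)"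
    using main_angle_0_iff[OF npos, of t1] main_angle_0_iff[OF npos, of t2]
    by (simp_all add: \<beta>_def t1_def t2_def L_def)
  have m: "m 1 = card (K t1)" "m 2 = card (K t2)"
    using eig_mult_eq[of t1] eig_mult_eq[of t2] by (simp_all add: m_def t1_def t2_def L_def)
  then have [simp]: "m (Suc 0) = card (K t1)" "m 2 = card (K t2)" by simp_all
  have s2: "s \<ge> 2" using \<open>length L \<ge> 2\<close> by (simp add: s_def L_def)
  have C: "C \<theta> = (\<Sum>i=1..s. real n * (\<beta> i)\<^sup>2 / (\<tau> i - \<theta>))" for \<theta>
    unfolding C_eq[OF npos] s_def n_def \<beta>_def \<tau>_def ..
  have c1: "(\<Sum>i=2..s. real n * (\<beta> i)\<^sup>2 / (\<tau> i - \<tau> 1)) = C t1"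
  proof -
    \<comment> \<open>The term for 1 divides by \<tau> 1 - \<tau> 1 and is 0.\<close>
    have eq: "{1..s} = insert 1 {2..s}" using s2 by auto
    show ?thesis unfolding C eq by (simp add: \<tau> del: One_nat_def)
  qed
  have c2: "real n * (\<beta> 1)\<^sup>2 / (\<tau> 1 - \<tau> 2) + (\<Sum>i=3..s. real n * (\<beta> i)\<^sup>2 / (\<tau> i - \<tau> 2)) = C t2"
  proof -
    have eq: "{1..s} = insert 1 (insert 2 {3..s})" using s2 by auto
    show ?thesis unfolding C eq by (simp add: \<tau> del: One_nat_def)
  qed
  \<comment> \<open>Dimension n - 1 always suffices: any \<theta> below the spectrum, here
    \<open>t1 - 1\<close>, with its critical c leaves a one-dimensional supply of kernel
    vectors.\<close>
  have n1: "\<exists>d\<le>n - 1. representable V E d"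
  proof -
    have "K (t1 - 1) = {}" using t1_le by (force simp: K_def)
    moreover have "\<And>k. k < card V \<Longrightarrow> t1 - 1 \<le> \<mu> k" using t1_le by force
    ultimately have "C (t1 - 1) > 0" "psd (t1 - 1) (- 1 / C (t1 - 1))"
      using C_pos[of "t1 - 1"] psd_neg[of "t1 - 1"] by auto
    then show ?thesis
      using representable_critical[of "t1 - 1"] \<open>K (t1 - 1) = {}\<close> by (simp add: n_def)
  qed
  \<comment> \<open>Only \<theta> = \<open>t1\<close> competes: off the spectrum the dimension is at
    least n - 1, and \<theta> = \<open>t2\<close> would require a nonzero g on
    \<open>K t1\<close>.\<close>
  have case1: "representable V E (Rep V E) \<and> Rep V E = n - m 1 - 1 \<and>
      (\<forall>\<phi> \<alpha>. is_representation V E (Rep V E) \<phi> \<alpha> \<longrightarrow>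
         \<alpha> = (1 - of_real (C t1) * \<i>) / (1 + of_real (C t1 * t1)))" if "\<beta> 1 = 0"
  proof -
    have g0: "\<And>k. k \<in> K t1 \<Longrightarrow> g k = 0" using that \<beta> by blast
    have lower: "n - m 1 - 1 \<le> d \<and> (d = n - m 1 - 1 \<longrightarrow>
        \<alpha> = (1 - of_real (C t1) * \<i>) / (1 + of_real (C t1 * t1)))"
      if rep: "is_representation V E d \<phi> \<alpha>" for d \<phi> \<alpha>
    proof -
      obtain \<theta> c where psd: "psd \<theta> c" and rk: "rank_le d \<theta> c"
        and \<alpha>: "\<alpha> = (of_real c + \<i>) / of_real (c - \<theta>)"
        using representationD[OF rep] by blast
      from psd show ?thesis
      proof (cases rule: psd_cases)
        case nonspectral
        have "n - 1 \<le> d" using rank_ge_nonspectral[OF rk nonspectral(1)] by (simp add: n_def)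
        then show ?thesis using K_pos(1) n2 by (auto simp: m n_def)
      next
        case first
        note crit = rank_ge_critical[OF rk[unfolded first] g0]
        show ?thesis using crit critical_angle[OF \<alpha>, of "C t1"] by (auto simp: m n_def first)
      next
        case second
        then show ?thesis using g0 by blast
      qed
    qed
    have "C t1 > 0" "psd t1 (- 1 / C t1)"
      using C_pos[OF t1_le g0] psd_neg[OF t1_le g0] by auto
    then have "\<exists>d\<le>n - m 1 - 1. representable V E d"
      using representable_critical[OF _ g0] by (simp add: m n_def)
    from Rep_eqI[OF this] lower show ?thesis by blast
  qed
  \<comment> \<open>A multiple smallest eigenvalue excludes \<theta> = \<open>t2\<close>, and n - 1
    is too large. At \<theta> = \<open>t1\<close> a nonzero c exceeds the bound, so c = 0.\<close>
  have case2: "representable V E (Rep V E) \<and> Rep V E = n - m 1 \<and>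
      (\<forall>\<phi> \<alpha>. is_representation V E (Rep V E) \<phi> \<alpha> \<longrightarrow> \<alpha> = - \<i> / of_real t1)"
    if b1: "\<beta> 1 \<noteq> 0" and m1: "m 1 > 1"
  proof -
    obtain k0 where k0: "k0 \<in> K t1" "g k0 \<noteq> 0" using b1 \<beta> by blast
    have lower: "n - m 1 \<le> d \<and> (d = n - m 1 \<longrightarrow> \<alpha> = - \<i> / of_real t1)"
      if rep: "is_representation V E d \<phi> \<alpha>" for d \<phi> \<alpha>
    proof -
      obtain \<theta> c where psd: "psd \<theta> c" and rk: "rank_le d \<theta> c"
        and \<alpha>: "\<alpha> = (of_real c + \<i>) / of_real (c - \<theta>)"
        using representationD[OF rep] by blast
      from psd show ?thesis
      proof (cases rule: psd_cases)
        case nonspectral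
        have "n - 1 \<le> d" using rank_ge_nonspectral[OF rk nonspectral(1)] by (simp add: n_def)
        then show ?thesis using m1 n2 by (auto simp: n_def)
      next
        case first
        note main = rank_ge_main[OF rk[unfolded first] k0]
        have "c = 0" if "d = n - m 1" using main(2) that by (auto simp: m n_def)
        then show ?thesis using main(1) \<alpha> by (auto simp: m n_def first)
      next
        case second
        then show ?thesis using m1 m by simp
      qed
    qed
    have "\<exists>d\<le>n - m 1. representable V E d"
      using representable_psd_0[OF t1_le] by (simp add: m n_def)
    from Rep_eqI[OF this] lower show ?thesis by blast
  qed
  have case3: "representable V E (Rep V E) \<and> Rep V E = n - m 2 - 1 \<and>
      (\<forall>\<phi> \<alpha>. is_representation V E (Rep V E) \<phi> \<alpha> \<longrightarrow>
         \<alpha> = (1 - of_real (C t2) * \<i>) / (1 + of_real (C t2 * t2)))"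
    if m1: "m 1 = 1" and b2: "\<beta> 2 = 0" and c2: "C t2 < 0"
  proof -
    have g0: "\<And>k. k \<in> K t2 \<Longrightarrow> g k = 0" using b2 \<beta> by blast
    have "card (K t1) = 1" using m1 m(1) by simp
    then obtain k1 where K1: "K t1 = {k1}" by (rule card_1_singletonE)
    have "k1 \<in> K t1" unfolding K1 by simp
    then have k1: "k1 < card V" "\<mu> k1 < t2" using t(3) by (simp_all add: K_def)
    have ge: "t2 \<le> \<mu> k" if "k < card V" "k \<noteq> k1" for k
    proof -
      have "k \<notin> K t1" unfolding K1 using that(2) by simp
      then show ?thesis using gap that(1) by (auto simp: K_def)
    qed
    have psd2: "psd t2 (- 1 / C t2)" by (rule psd_pos[OF k1 ge g0 c2])
    \<comment> \<open>Semidefiniteness at \<open>t2\<close> already forces the first main angle to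
      be nonzero; hence \<theta> = \<open>t1\<close> costs n - 1 dimensions and cannot
      compete.\<close>
    have b1: "\<exists>k\<in>K t1. g k \<noteq> 0" using psd_below(1)[OF psd2 k1] K1 by blast
    have lower: "n - m 2 - 1 \<le> d \<and> (d = n - m 2 - 1 \<longrightarrow>
        \<alpha> = (1 - of_real (C t2) * \<i>) / (1 + of_real (C t2 * t2)))"
      if rep: "is_representation V E d \<phi> \<alpha>" for d \<phi> \<alpha>
    proof -
      obtain \<theta> c where psd: "psd \<theta> c" and rk: "rank_le d \<theta> c"
        and \<alpha>: "\<alpha> = (of_real c + \<i>) / of_real (c - \<theta>)"
        using representationD[OF rep] by blast
      from psd show ?thesis
      proof (cases rule: psd_cases)
        case nonspectral
        have "n - 1 \<le> d" using rank_ge_nonspectral[OF rk nonspectral(1)] by (simp add: n_def)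
        then show ?thesis using K_pos(2) n2 by (auto simp: m n_def)
      next
        case first
        have "n - 1 \<le> d" using rank_ge_main(1)[OF rk[unfolded first]] b1 K1 by (auto simp: n_def)
        then show ?thesis using K_pos(2) n2 by (auto simp: m n_def)
      next
        case second
        note crit = rank_ge_critical[OF rk[unfolded second(1)] g0]
        show ?thesis using crit critical_angle[OF \<alpha>, of "C t2"] by (auto simp: m n_def second(1))
      qed
    qed
    have "\<exists>d\<le>n - m 2 - 1. representable V E d"
      using representable_critical[OF psd2 g0] c2 by (simp add: m n_def)
    from Rep_eqI[OF this] lower show ?thesis by blast
  qed
  \<comment> \<open>Here \<open>t1\<close> is simple with nonzero main angle, so \<theta> =
    \<open>t1\<close> gives no less than n - 1, and semidefiniteness at \<theta> = \<open>t2\<close>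
    would bring back the conditions of the third case.\<close>
  have case4: "representable V E (Rep V E) \<and> Rep V E = n - 1"
    if b1: "\<not> \<beta> 1 = 0" and not2: "\<not> (\<beta> 1 \<noteq> 0 \<and> m 1 > 1)"
      and not3: "\<not> (m 1 = 1 \<and> \<beta> 2 = 0 \<and> C t2 < 0)"
  proof -
    obtain k0 where k0: "k0 \<in> K t1" "g k0 \<noteq> 0" using b1 \<beta>(1) by blast
    have m1: "card (K t1) = 1" using b1 not2 K_pos(1) m(1) by linarith
    have lower: "n - 1 \<le> d" if rep: "is_representation V E d \<phi> \<alpha>" for d \<phi> \<alpha>
    proof -
      obtain \<theta> c where psd: "psd \<theta> c" and rk: "rank_le d \<theta> c"
        using representationD[OF rep] by blast
      from psd show ?thesis
      proof (cases rule: psd_cases)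
        case nonspectral
        then show ?thesis using rank_ge_nonspectral[OF rk] by (simp add: n_def)
      next
        case first
        show ?thesis using rank_ge_main(1)[OF rk[unfolded first] k0] m1 by (simp add: n_def)
      next
        case second
        then show ?thesis using not3 \<beta>(2) m(1) by simp
      qed
    qed
    from Rep_eqI[OF n1] lower show ?thesis by blast
  qed
  show ?thesis
    unfolding Let_def c1 c2 unfolding \<tau> using case1 case2 case3 case4 by blast
qed

end
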